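(* Let $0<\alpha\le 0.05$, let $\mathbf{x}\in\mathbb{R}^N$, let $s_{ij}$ ($1\le i\le N$, $1\le j\le M$) be i.i.d. $S(\alpha,1)$, $y_j=\sum_{i=1}^Nx_is_{ij}$, and $\hat x_{i,min}=y_t/s_{it}$ with $t=\arg\min_{1\le j\le M}|y_j/s_{ij}|$. Let $\epsilon>0$, fix a coordinate $i$ with $|x_i|>\epsilon$, and let $\theta_i=\left(\sum_{t\ne i}|x_t|^\alpha\right)^{1/\alpha}>0$. Assume $\left(\frac{|x_i|+\epsilon}{\theta_i}\right)^{\alpha/(1-\alpha)}<1/3$. Then $$\Pr\left(|\hat x_{i,min}|\le\epsilon\right)\le 1-\left[1-\frac34\left|\frac{|x_i|+\epsilon}{\theta_i}\right|^{\frac{\alpha}{1+\alpha}}\left(1-\left|\frac{|x_i|-\epsilon}{|x_i|+\epsilon}\right|^{\alpha/(1-\alpha)}\right)\right]^M.$$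
   Context: A random variable $Z$ has the symmetric $\alpha$-stable distribution with unit scale, $S(\alpha,1)$, if its characteristic function is $E e^{\sqrt{-1}Zt}=e^{-|t|^\alpha}$. *)

theory Defs
  imports "HOL-Probability.Probability"
begin

definition meas :: "(nat \<Rightarrow> real) \<Rightarrow> (nat \<Rightarrow> nat \<Rightarrow> 'a \<Rightarrow> real) \<Rightarrow> nat \<Rightarrow> nat \<Rightarrow> 'a \<Rightarrow> real" where
  "meas x s N j \<omega> = (\<Sum>i=1..N. x i * s i j \<omega>)"

text \<open>Minimum estimator: xhat_{i,min} = y_t / s_{it}, t = argmin_{1<=j<=M} |y_j / s_ij|
  (ties, which occur with probability zero, are broken by arg_min_on).\<close>
definition xhat_min :: "(nat \<Rightarrow> real) \<Rightarrow> (nat \<Rightarrow> nat \<Rightarrow> 'a \<Rightarrow> real) \<Rightarrow> nat \<Rightarrow> nat \<Rightarrow> nat \<Rightarrow> 'a \<Rightarrow> real" where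
  "xhat_min x s N M i \<omega> =
     (let t = arg_min_on (\<lambda>j. \<bar>meas x s N j \<omega> / s i j \<omega>\<bar>) {1..M}
      in meas x s N t \<omega> / s i t \<omega>)"

end

theory Submission
  imports Defs "HOL-Real_Asymp.Real_Asymp"
begin

text \<open>Writing \<open>S = s\<^sub>i\<^sub>j\<close>, we have \<open>y\<^sub>j / S = x\<^sub>i + \<theta> Z / S\<close> with \<open>Z\<close> an independent copy of \<open>S\<close>, so
  by symmetry \<open>Pr (\<bar>y\<^sub>j / S\<bar> \<le> \<epsilon>) = (F b - F a) / 2\<close>, where \<open>F\<close> is the distribution function of
  \<open>\<bar>Z / S\<bar>\<close>, \<open>a = (\<bar>x\<^sub>i\<bar> - \<epsilon>) / \<theta>\<close> and \<open>b = (\<bar>x\<^sub>i\<bar> + \<epsilon>) / \<theta> < 1\<close>.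

  Since \<open>1 - 2 F b = E [sgn (Z - b S) sgn (Z + b S)]\<close>, inserting \<open>sgn y = 2/\<pi> \<integral> sin (u y) / u du\<close>
  over \<open>(0, \<infinity>)\<close> for both factors expresses \<open>F b\<close> as a double integral of characteristic functions.
  In the coordinates \<open>u = p (1 + m) / 2\<close>, \<open>v = p (1 - m) / 2\<close> the integral over \<open>p\<close> is a Frullani
  integral. With \<open>T = b\<^sup>\<alpha>\<close> this gives
  \<open>F b = 4 / (\<alpha> \<pi>\<^sup>2) \<integral> ln ((1 + T m\<^sup>-\<^sup>\<alpha>) / (1 + T m\<^sup>\<alpha>)) / (1 - m\<^sup>2) dm\<close> over \<open>(0, 1)\<close>.

  The integrand is concave in \<open>T\<close> and vanishes at \<open>T = 0\<close>, so \<open>F b - F a \<le> F b (1 - (a / b)\<^sup>\<alpha>)\<close>, and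
  it is at most \<open>- 2 \<alpha> T m\<^sup>-\<^sup>\<alpha> ln m / (1 - m\<^sup>2)\<close>, so \<open>F b \<le> b\<^sup>\<alpha> / (1 - \<alpha>)\<^sup>2\<close>. The exponents in the
  theorem are weaker because \<open>b < 1\<close>, and \<open>1 / (2 (1 - \<alpha>)\<^sup>2) \<le> 3 / 4\<close>.\<close>

section \<open>Integrals on the line\<close>

lemma nn_integral_FTC_einterval:
  fixes f F :: "real \<Rightarrow> real" and a b :: ereal
  assumes "a < b"
    and deriv: "\<And>x. a < ereal x \<Longrightarrow> ereal x < b \<Longrightarrow> DERIV F x :> f x"
    and cont: "\<And>x. a < ereal x \<Longrightarrow> ereal x < b \<Longrightarrow> isCont f x"
    and nonneg: "\<And>x. a < ereal x \<Longrightarrow> ereal x < b \<Longrightarrow> 0 \<le> f x"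
    and lims: "((F \<circ> real_of_ereal) \<longlongrightarrow> A) (at_right a)" "((F \<circ> real_of_ereal) \<longlongrightarrow> B) (at_left b)"
  shows "(\<integral>\<^sup>+x\<in>einterval a b. ennreal (f x) \<partial>lborel) = ennreal (B - A)"
proof -
  have "AE x in lborel. a < ereal x \<longrightarrow> ereal x < b \<longrightarrow> 0 \<le> f x"
    using nonneg by auto
  note ftc = interval_integral_FTC_nonneg[OF \<open>a < b\<close> deriv cont this lims]
  have "(\<integral>\<^sup>+x\<in>einterval a b. ennreal (f x) \<partial>lborel)
      = (\<integral>\<^sup>+x. ennreal (indicator (einterval a b) x *\<^sub>R f x) \<partial>lborel)"
    by (intro nn_integral_cong) (auto split: split_indicator)
  also have "\<dots> = ennreal (\<integral>x. indicator (einterval a b) x *\<^sub>R f x \<partial>lborel)"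
    using ftc(1) nonneg
    by (intro nn_integral_eq_integral)
      (auto simp: set_integrable_def einterval_def split: split_indicator)
  also have "(\<integral>x. indicator (einterval a b) x *\<^sub>R f x \<partial>lborel) = B - A"
    using ftc(2) \<open>a < b\<close>
    by (simp add: interval_lebesgue_integral_def set_lebesgue_integral_def less_imp_le)
  finally show ?thesis .
qed

lemma nn_integral_FTC_Ioo:
  fixes f F :: "real \<Rightarrow> real"
  assumes "a < b"
    and "\<And>x. a < x \<Longrightarrow> x < b \<Longrightarrow> DERIV F x :> f x"
    and "\<And>x. a < x \<Longrightarrow> x < b \<Longrightarrow> isCont f x"
    and "\<And>x. a < x \<Longrightarrow> x < b \<Longrightarrow> 0 \<le> f x"
    and "(F \<longlongrightarrow> A) (at_right a)" "(F \<longlongrightarrow> B) (at_left b)"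
  shows "(\<integral>\<^sup>+x\<in>{a<..<b}. ennreal (f x) \<partial>lborel) = ennreal (B - A)"
proof -
  have "einterval (ereal a) (ereal b) = {a<..<b}"
    by (auto simp: einterval_def)
  with nn_integral_FTC_einterval[of "ereal a" "ereal b" F f A B] assms show ?thesis
    by (simp add: ereal_tendsto_simps)
qed

lemma nn_integral_FTC_Ioi:
  fixes f F :: "real \<Rightarrow> real"
  assumes "\<And>x. a < x \<Longrightarrow> DERIV F x :> f x"
    and "\<And>x. a < x \<Longrightarrow> isCont f x"
    and "\<And>x. a < x \<Longrightarrow> 0 \<le> f x"
    and "(F \<longlongrightarrow> A) (at_right a)" "(F \<longlongrightarrow> B) at_top"
  shows "(\<integral>\<^sup>+x\<in>{a<..}. ennreal (f x) \<partial>lborel) = ennreal (B - A)"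
proof -
  have "einterval (ereal a) \<infinity> = {a<..}"
    by (auto simp: einterval_def)
  with nn_integral_FTC_einterval[of "ereal a" "\<infinity>" F f A B] assms show ?thesis
    by (simp add: ereal_tendsto_simps)
qed

lemma nn_integral_Ioi_dilated_derivative:
  fixes f f' :: "real \<Rightarrow> real"
  assumes "0 < y"
    and deriv: "\<And>x. 0 < x \<Longrightarrow> DERIV f x :> f' x"
    and cont: "\<And>x. 0 < x \<Longrightarrow> isCont f' x"
    and decreasing: "\<And>x. 0 < x \<Longrightarrow> f' x \<le> 0"
    and lims: "(f \<longlongrightarrow> L) (at_right 0)" "(f \<longlongrightarrow> l) at_top"
  shows "(\<integral>\<^sup>+x\<in>{0<..}. ennreal (- f' (y * x)) \<partial>lborel) = ennreal ((L - l) / y)"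
proof -
  have "(\<integral>\<^sup>+x\<in>{0<..}. ennreal (- f' (y * x)) \<partial>lborel) = ennreal (- l / y - - L / y)"
  proof (rule nn_integral_FTC_Ioi[where F = "\<lambda>x. - f (y * x) / y"])
    have "filterlim (\<lambda>x. y * x) (at_right 0) (at_right 0)"
      using \<open>0 < y\<close> by real_asymp
    then show "((\<lambda>x. - f (y * x) / y) \<longlongrightarrow> - L / y) (at_right 0)"
      using \<open>0 < y\<close> by (intro tendsto_intros filterlim_compose[OF lims(1)]) auto
    have "filterlim (\<lambda>x. y * x) at_top at_top"
      using \<open>0 < y\<close> by real_asymp
    then show "((\<lambda>x. - f (y * x) / y) \<longlongrightarrow> - l / y) at_top"
      using \<open>0 < y\<close> by (intro tendsto_intros filterlim_compose[OF lims(2)]) auto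
    fix x :: real assume "0 < x"
    then have pos: "0 < y * x" using \<open>0 < y\<close> by simp
    have "DERIV (\<lambda>x. f (y * x)) x :> f' (y * x) * y"
      by (rule DERIV_chain2[where f = f and g = "\<lambda>x. y * x", OF deriv[OF pos]])
        (auto intro!: derivative_eq_intros)
    then show "DERIV (\<lambda>x. - f (y * x) / y) x :> - f' (y * x)"
      using \<open>0 < y\<close> by (auto intro!: derivative_eq_intros)
    show "isCont (\<lambda>x. - f' (y * x)) x"
      using isCont_o2[of x "\<lambda>x. y * x" f'] cont[OF pos] by (intro continuous_minus) auto
    show "0 \<le> - f' (y * x)"
      using decreasing[OF pos] by simp
  qed
  then show ?thesis by (simp add: diff_divide_distrib)
qed

lemma nn_integral_Icc_dilated_derivative:
  fixes f f' :: "real \<Rightarrow> real"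
  assumes [measurable]: "f' \<in> borel_measurable borel"
    and "0 < A" "A \<le> B" "0 < x"
    and deriv: "\<And>x. 0 < x \<Longrightarrow> DERIV f x :> f' x"
    and decreasing: "\<And>x. 0 < x \<Longrightarrow> f' x \<le> 0"
  shows "(\<integral>\<^sup>+y\<in>{A..B}. ennreal (- f' (y * x)) \<partial>lborel) = ennreal ((f (A * x) - f (B * x)) / x)"
proof -
  have "(\<integral>\<^sup>+y\<in>{A..B}. ennreal (- f' (y * x)) \<partial>lborel) = ennreal (- f (B * x) / x - - f (A * x) / x)"
  proof (rule nn_integral_FTC_Icc)
    fix y assume "y \<in> {A..B}"
    then have pos: "0 < y * x" using \<open>0 < A\<close> \<open>0 < x\<close> by simp
    have "DERIV (\<lambda>y. f (y * x)) y :> f' (y * x) * x"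
      by (rule DERIV_chain2[where f = f and g = "\<lambda>y. y * x", OF deriv[OF pos]])
        (auto intro!: derivative_eq_intros)
    then show "DERIV (\<lambda>y. - f (y * x) / x) y :> - f' (y * x)"
      using \<open>0 < x\<close> by (auto intro!: derivative_eq_intros)
    show "0 \<le> - f' (y * x)"
      using decreasing[OF pos] by simp
  qed (use \<open>A \<le> B\<close> in auto)
  then show ?thesis by (simp add: diff_divide_distrib)
qed

lemma nn_integral_frullani:
  fixes f f' :: "real \<Rightarrow> real"
  assumes [measurable]: "f' \<in> borel_measurable borel"
    and "0 < A" "A \<le> B"
    and deriv: "\<And>x. 0 < x \<Longrightarrow> DERIV f x :> f' x"
    and cont: "\<And>x. 0 < x \<Longrightarrow> isCont f' x"
    and decreasing: "\<And>x. 0 < x \<Longrightarrow> f' x \<le> 0"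
    and lims: "(f \<longlongrightarrow> L) (at_right 0)" "(f \<longlongrightarrow> l) at_top"
    and "l \<le> L"
  shows "(\<integral>\<^sup>+x\<in>{0<..}. ennreal ((f (A * x) - f (B * x)) / x) \<partial>lborel)
      = ennreal ((L - l) * ln (B / A))"
proof -
  have "(\<integral>\<^sup>+x\<in>{0<..}. ennreal ((f (A * x) - f (B * x)) / x) \<partial>lborel)
      = (\<integral>\<^sup>+x\<in>{0<..}. (\<integral>\<^sup>+y\<in>{A..B}. ennreal (- f' (y * x)) \<partial>lborel) \<partial>lborel)"
    using assms(1-3)
    by (intro set_nn_integral_cong refl nn_integral_Icc_dilated_derivative[symmetric]
      deriv decreasing) auto
  also have "\<dots> = (\<integral>\<^sup>+x. \<integral>\<^sup>+y. ennreal (- f' (y * x)) * indicator {A..B} y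
      * indicator {0<..} x \<partial>lborel \<partial>lborel)"
    by (simp add: nn_integral_multc)
  also have "\<dots> = (\<integral>\<^sup>+y. \<integral>\<^sup>+x. ennreal (- f' (y * x)) * indicator {A..B} y
      * indicator {0<..} x \<partial>lborel \<partial>lborel)"
    by (rule lborel_pair.Fubini'[symmetric]) measurable
  also have "\<dots> = (\<integral>\<^sup>+y. \<integral>\<^sup>+x. ennreal (- f' (y * x)) * indicator {0<..} x
      * indicator {A..B} y \<partial>lborel \<partial>lborel)"
    by (simp only: mult_ac)
  also have "\<dots> = (\<integral>\<^sup>+y\<in>{A..B}. (\<integral>\<^sup>+x\<in>{0<..}. ennreal (- f' (y * x)) \<partial>lborel) \<partial>lborel)"
    by (simp add: nn_integral_multc)
  also have "\<dots> = (\<integral>\<^sup>+y\<in>{A..B}. ennreal ((L - l) / y) \<partial>lborel)"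
    using \<open>0 < A\<close>
    by (intro set_nn_integral_cong refl
      nn_integral_Ioi_dilated_derivative[OF _ deriv cont decreasing lims]) auto
  also have "\<dots> = ennreal ((L - l) * ln B - (L - l) * ln A)"
    using assms(2,3) \<open>l \<le> L\<close>
    by (intro nn_integral_FTC_Icc) (auto intro!: derivative_eq_intros)
  also have "(L - l) * ln B - (L - l) * ln A = (L - l) * ln (B / A)"
    using assms(2,3) by (simp add: ln_div right_diff_distrib)
  finally show ?thesis .
qed

lemma nn_integral_frullani_stretched_exp:
  fixes A B \<alpha> :: real
  assumes "0 < A" "A \<le> B" "0 < \<alpha>"
  shows "(\<integral>\<^sup>+x\<in>{0<..}. ennreal ((exp (- (A * x powr \<alpha>)) - exp (- (B * x powr \<alpha>))) / x) \<partial>lborel)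
    = ennreal (ln (B / A) / \<alpha>)"
proof -
  have root: "(y powr (1 / \<alpha>) * x) powr \<alpha> = y * x powr \<alpha>" if "0 < y" "0 < x" for x y
    using that assms by (simp add: powr_mult powr_powr)
  have "(\<integral>\<^sup>+x\<in>{0<..}. ennreal ((exp (- (A * x powr \<alpha>)) - exp (- (B * x powr \<alpha>))) / x) \<partial>lborel)
    = (\<integral>\<^sup>+x\<in>{0<..}. ennreal ((exp (- ((A powr (1 / \<alpha>) * x) powr \<alpha>))
        - exp (- ((B powr (1 / \<alpha>) * x) powr \<alpha>))) / x) \<partial>lborel)"
    using assms by (intro set_nn_integral_cong) (auto simp: root)
  also have "\<dots> = ennreal ((1 - 0) * ln (B powr (1 / \<alpha>) / A powr (1 / \<alpha>)))"
  proof (rule nn_integral_frullani[where f = "\<lambda>x. exp (- (x powr \<alpha>))"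
        and f' = "\<lambda>x. - (\<alpha> * x powr (\<alpha> - 1) * exp (- (x powr \<alpha>)))"])
    show "((\<lambda>x. exp (- (x powr \<alpha>))) \<longlongrightarrow> 1) (at_right 0)" "((\<lambda>x. exp (- (x powr \<alpha>))) \<longlongrightarrow> 0) at_top"
      using assms by real_asymp+
    fix x :: real assume "0 < x"
    then show "DERIV (\<lambda>x. exp (- (x powr \<alpha>))) x :> - (\<alpha> * x powr (\<alpha> - 1) * exp (- (x powr \<alpha>)))"
      by (auto intro!: derivative_eq_intros)
    show "isCont (\<lambda>x. - (\<alpha> * x powr (\<alpha> - 1) * exp (- (x powr \<alpha>)))) x"
      using \<open>0 < x\<close> by (auto intro!: continuous_intros)
  qed (use assms in \<open>auto intro!: powr_mono2\<close>)
  also have "(1 - 0) * ln (B powr (1 / \<alpha>) / A powr (1 / \<alpha>)) = ln (B / A) / \<alpha>"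
    using assms by (simp add: ln_div ln_powr diff_divide_distrib)
  finally show ?thesis .
qed

lemma nn_integral_neg_ln_powr:
  fixes c :: real
  assumes "0 < c"
  shows "(\<integral>\<^sup>+m\<in>{0<..<1}. ennreal (- ln m * m powr (c - 1)) \<partial>lborel) = ennreal (1 / c\<^sup>2)"
proof -
  let ?F = "\<lambda>m. m powr c / c\<^sup>2 - ln m * m powr c / c"
  have "(\<integral>\<^sup>+m\<in>{0<..<1}. ennreal (- ln m * m powr (c - 1)) \<partial>lborel) = ennreal (1 / c\<^sup>2 - 0)"
  proof (rule nn_integral_FTC_Ioo[where F = ?F])
    fix m :: real assume "0 < m" "m < 1"
    then show "DERIV ?F m :> - ln m * m powr (c - 1)"
      using assms by (auto intro!: derivative_eq_intros
        simp: field_simps power2_eq_square powr_diff)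
    show "isCont (\<lambda>m. - ln m * m powr (c - 1)) m"
      using \<open>0 < m\<close> by (auto intro!: continuous_intros)
  next
    show "(?F \<longlongrightarrow> 0) (at_right 0)" using assms by real_asymp
    show "(?F \<longlongrightarrow> 1 / c\<^sup>2) (at_left 1)" using assms by (real_asymp simp: field_simps)
  qed (auto simp: mult_nonpos_nonneg)
  then show ?thesis by simp
qed

lemma nn_integral_neg_ln_powr_weight:
  fixes a :: real
  assumes "a < 1"
  shows "(\<integral>\<^sup>+m\<in>{0<..<1}. ennreal (- ln m * m powr (- a) / (1 - m\<^sup>2)) \<partial>lborel)
    = (\<Sum>k. ennreal (1 / (2 * real k + 1 - a)\<^sup>2))"
proof -
  let ?term = "\<lambda>k m. - ln m * m powr (2 * real k + 1 - a - 1)"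
  have "(\<integral>\<^sup>+m\<in>{0<..<1}. ennreal (- ln m * m powr (- a) / (1 - m\<^sup>2)) \<partial>lborel)
      = (\<integral>\<^sup>+m. (\<Sum>k. ennreal (?term k m) * indicator {0<..<1} m) \<partial>lborel)"
  proof (rule nn_integral_cong)
    fix m :: real
    show "ennreal (- ln m * m powr (- a) / (1 - m\<^sup>2)) * indicator {0<..<1} m
        = (\<Sum>k. ennreal (?term k m) * indicator {0<..<1} m)"
    proof (cases "m \<in> {0<..<1}")
      case True
      then have "m\<^sup>2 < 1" by (simp add: power_less_one_iff)
      have geometric: "?term k m = - ln m * m powr (- a) * (m\<^sup>2) ^ k" for k
        using True powr_add[of m "- a" "real (2 * k)"] powr_realpow[of m "2 * k"]
          power_mult[of m 2 k]
        by (simp add: algebra_simps)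
      have "(\<lambda>k. ?term k m) sums (- ln m * m powr (- a) * (1 / (1 - m\<^sup>2)))"
        unfolding geometric using \<open>m\<^sup>2 < 1\<close> by (intro sums_mult geometric_sums) simp
      then have "(\<lambda>k. ?term k m) sums (- ln m * m powr (- a) / (1 - m\<^sup>2))" by simp
      moreover have "0 \<le> ?term k m" for k
        using True by (simp add: mult_nonpos_nonneg)
      ultimately have "(\<Sum>k. ennreal (?term k m)) = ennreal (- ln m * m powr (- a) / (1 - m\<^sup>2))"
        by (intro suminf_ennreal_eq) auto
      then show ?thesis using True by simp
    qed simp
  qed
  also have "\<dots> = (\<Sum>k. \<integral>\<^sup>+m\<in>{0<..<1}. ennreal (?term k m) \<partial>lborel)"
    by (rule nn_integral_suminf) measurable
  also have "\<dots> = (\<Sum>k. ennreal (1 / (2 * real k + 1 - a)\<^sup>2))"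
    using assms by (subst nn_integral_neg_ln_powr) auto
  finally show ?thesis .
qed

lemma odd_inverse_squares_sums: "(\<lambda>k. 1 / (2 * real k + 1)\<^sup>2) sums (pi\<^sup>2 / 8)"
proof -
  let ?f = "\<lambda>n. 1 / (real n + 1)\<^sup>2"
  have basel: "?f sums (pi\<^sup>2 / 6)"
    using inverse_squares_sums by (simp add: add.commute)
  have "(\<lambda>n. \<Sum>i = n * 2..<n * 2 + 2. ?f i) sums (pi\<^sup>2 / 6)"
    by (rule sums_group[OF basel]) simp
  from sums_diff[OF this sums_mult[OF basel, of "1 / 4"]]
  have "(\<lambda>n. (\<Sum>i = n * 2..<n * 2 + 2. ?f i) - 1 / 4 * ?f n) sums (pi\<^sup>2 / 8)"
    by (simp add: field_simps)
  also have "(\<lambda>n. (\<Sum>i = n * 2..<n * 2 + 2. ?f i) - 1 / 4 * ?f n) = (\<lambda>k. 1 / (2 * real k + 1)\<^sup>2)"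
  proof
    fix n :: nat
    have "1 / 4 * ?f n = 1 / (2 * real n + 2)\<^sup>2"
      by (simp add: power2_eq_square field_simps)
    then show "(\<Sum>i = n * 2..<n * 2 + 2. ?f i) - 1 / 4 * ?f n = 1 / (2 * real n + 1)\<^sup>2"
      by (simp add: numeral_2_eq_2 add.commute mult.commute)
  qed
  finally show ?thesis .
qed

lemma nn_integral_neg_ln_weight:
  "(\<integral>\<^sup>+m\<in>{0<..<1::real}. ennreal (- ln m / (1 - m\<^sup>2)) \<partial>lborel) = ennreal (pi\<^sup>2 / 8)"
proof -
  have "(\<integral>\<^sup>+m\<in>{0<..<1::real}. ennreal (- ln m / (1 - m\<^sup>2)) \<partial>lborel)
      = (\<integral>\<^sup>+m\<in>{0<..<1::real}. ennreal (- ln m * m powr (- 0) / (1 - m\<^sup>2)) \<partial>lborel)"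
    by (intro set_nn_integral_cong) auto
  also have "\<dots> = (\<Sum>k. ennreal (1 / (2 * real k + 1)\<^sup>2))"
    by (subst nn_integral_neg_ln_powr_weight) auto
  also have "\<dots> = ennreal (pi\<^sup>2 / 8)"
    by (intro suminf_ennreal_eq odd_inverse_squares_sums) auto
  finally show ?thesis .
qed

lemma nn_integral_neg_ln_powr_weight_le:
  fixes a :: real
  assumes "0 \<le> a" "a < 1"
  shows "(\<integral>\<^sup>+m\<in>{0<..<1}. ennreal (- ln m * m powr (- a) / (1 - m\<^sup>2)) \<partial>lborel)
    \<le> ennreal (1 / (1 - a)\<^sup>2 * (pi\<^sup>2 / 8))"
proof -
  have "1 / (2 * real k + 1 - a)\<^sup>2 \<le> 1 / (1 - a)\<^sup>2 * (1 / (2 * real k + 1)\<^sup>2)" for k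
  proof -
    have "(1 - a) * (2 * real k + 1) \<le> 2 * real k + 1 - a"
      using assms by (simp add: algebra_simps)
    then have "((1 - a) * (2 * real k + 1))\<^sup>2 \<le> (2 * real k + 1 - a)\<^sup>2"
      using assms by (intro power_mono) auto
    then have "1 / (2 * real k + 1 - a)\<^sup>2 \<le> 1 / ((1 - a) * (2 * real k + 1))\<^sup>2"
      using assms by (intro divide_left_mono) auto
    then show ?thesis by (simp add: power_mult_distrib)
  qed
  then have "(\<Sum>k. ennreal (1 / (2 * real k + 1 - a)\<^sup>2))
      \<le> (\<Sum>k. ennreal (1 / (1 - a)\<^sup>2 * (1 / (2 * real k + 1)\<^sup>2)))"
    by (intro suminf_le ennreal_leI) auto
  also have "\<dots> = ennreal (1 / (1 - a)\<^sup>2 * (pi\<^sup>2 / 8))"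
    by (intro suminf_ennreal_eq sums_mult odd_inverse_squares_sums) auto
  finally show ?thesis
    unfolding nn_integral_neg_ln_powr_weight[OF \<open>a < 1\<close>] .
qed

lemma nn_integral_lborel_even:
  fixes f :: "real \<Rightarrow> ennreal"
  assumes [measurable]: "f \<in> borel_measurable borel" and even: "\<And>x. f (- x) = f x"
  shows "(\<integral>\<^sup>+x. f x \<partial>lborel) = 2 * (\<integral>\<^sup>+x\<in>{0<..}. f x \<partial>lborel)"
proof -
  have "(\<integral>\<^sup>+x. f x \<partial>lborel) = (\<integral>\<^sup>+x. f x * indicator {0<..} x + f x * indicator {..<0} x \<partial>lborel)"
    using AE_lborel_singleton[of 0]
    by (intro nn_integral_cong_AE) (auto simp: indicator_def elim!: eventually_mono)
  also have "\<dots> = (\<integral>\<^sup>+x\<in>{0<..}. f x \<partial>lborel) + (\<integral>\<^sup>+x\<in>{..<0}. f x \<partial>lborel)"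
    by (rule nn_integral_add) measurable
  also have "(\<integral>\<^sup>+x\<in>{..<0}. f x \<partial>lborel) = (\<integral>\<^sup>+x\<in>{0<..}. f x \<partial>lborel)"
    by (subst nn_integral_real_affine[where c = "-1" and t = 0]) (auto simp: even indicator_def)
  finally show ?thesis by (simp add: mult_2)
qed

lemma nn_integral_pair_sum_ratio:
  fixes f :: "real \<times> real \<Rightarrow> ennreal"
  assumes [measurable]: "f \<in> borel_measurable (borel \<Otimes>\<^sub>M borel)"
  shows "(\<integral>\<^sup>+z. f z \<partial>(lborel \<Otimes>\<^sub>M lborel))
    = (\<integral>\<^sup>+m. \<integral>\<^sup>+p. f (p * (1 + m) / 2, p * (1 - m) / 2) * ennreal (\<bar>p\<bar> / 2) \<partial>lborel \<partial>lborel)"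
proof -
  have "(\<integral>\<^sup>+z. f z \<partial>(lborel \<Otimes>\<^sub>M lborel)) = (\<integral>\<^sup>+u. \<integral>\<^sup>+v. f (u, v) \<partial>lborel \<partial>lborel)"
    by (rule lborel.nn_integral_fst[symmetric]) measurable
  also have "\<dots> = (\<integral>\<^sup>+u. \<integral>\<^sup>+p. f (u, p - u) \<partial>lborel \<partial>lborel)"
  proof (rule nn_integral_cong)
    fix u :: real
    show "(\<integral>\<^sup>+v. f (u, v) \<partial>lborel) = (\<integral>\<^sup>+p. f (u, p - u) \<partial>lborel)"
      using nn_integral_real_affine[of "\<lambda>v. f (u, v)" 1 "- u"] by simp
  qed
  also have "\<dots> = (\<integral>\<^sup>+p. \<integral>\<^sup>+u. f (u, p - u) \<partial>lborel \<partial>lborel)"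
    by (rule lborel_pair.Fubini'[symmetric]) measurable
  also have "\<dots> = (\<integral>\<^sup>+p. \<integral>\<^sup>+m. f (p * (1 + m) / 2, p * (1 - m) / 2)
      * ennreal (\<bar>p\<bar> / 2) \<partial>lborel \<partial>lborel)"
  proof (rule nn_integral_cong_AE, use AE_lborel_singleton[of 0] in eventually_elim)
    fix p :: real assume "p \<noteq> 0"
    then have "(\<integral>\<^sup>+u. f (u, p - u) \<partial>lborel)
        = ennreal \<bar>p / 2\<bar> * (\<integral>\<^sup>+m. f (p / 2 + p / 2 * m, p - (p / 2 + p / 2 * m)) \<partial>lborel)"
      by (intro nn_integral_real_affine) auto
    also have "\<dots> = (\<integral>\<^sup>+m. f (p / 2 + p / 2 * m, p - (p / 2 + p / 2 * m)) * ennreal \<bar>p / 2\<bar> \<partial>lborel)"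
      by (subst mult.commute, rule nn_integral_multc[symmetric]) measurable
    also have "\<dots> = (\<integral>\<^sup>+m. f (p * (1 + m) / 2, p * (1 - m) / 2) * ennreal (\<bar>p\<bar> / 2) \<partial>lborel)"
      by (simp add: field_simps)
    finally show "(\<integral>\<^sup>+u. f (u, p - u) \<partial>lborel)
        = (\<integral>\<^sup>+m. f (p * (1 + m) / 2, p * (1 - m) / 2) * ennreal (\<bar>p\<bar> / 2) \<partial>lborel)" .
  qed
  also have "\<dots> = (\<integral>\<^sup>+m. \<integral>\<^sup>+p. f (p * (1 + m) / 2, p * (1 - m) / 2)
      * ennreal (\<bar>p\<bar> / 2) \<partial>lborel \<partial>lborel)"
    by (rule lborel_pair.Fubini'[symmetric]) measurable
  finally show ?thesis .
qed

lemma nn_integral_quadrant_sum_ratio: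
  fixes f :: "real \<times> real \<Rightarrow> ennreal"
  assumes [measurable]: "f \<in> borel_measurable (borel \<Otimes>\<^sub>M borel)"
  shows "(\<integral>\<^sup>+z\<in>{0<..} \<times> {0<..}. f z \<partial>(lborel \<Otimes>\<^sub>M lborel))
    = (\<integral>\<^sup>+m\<in>{-1<..<1}. (\<integral>\<^sup>+p\<in>{0<..}. f (p * (1 + m) / 2, p * (1 - m) / 2)
        * ennreal (p / 2) \<partial>lborel) \<partial>lborel)"
proof -
  have quadrant: "indicator ({0<..} \<times> {0<..}) (p * (1 + m) / 2, p * (1 - m) / 2)
      = (indicator {0<..} p * indicator {-1<..<1} m :: ennreal)" for p m :: real
    by (auto simp: zero_less_mult_iff indicator_def)
  have "(\<integral>\<^sup>+z\<in>{0<..} \<times> {0<..}. f z \<partial>(lborel \<Otimes>\<^sub>M lborel))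
    = (\<integral>\<^sup>+m. \<integral>\<^sup>+p. f (p * (1 + m) / 2, p * (1 - m) / 2)
        * indicator ({0<..} \<times> {0<..}) (p * (1 + m) / 2, p * (1 - m) / 2)
        * ennreal (\<bar>p\<bar> / 2) \<partial>lborel \<partial>lborel)"
    by (rule nn_integral_pair_sum_ratio) measurable
  also have "\<dots> = (\<integral>\<^sup>+m. \<integral>\<^sup>+p. f (p * (1 + m) / 2, p * (1 - m) / 2) * ennreal (p / 2)
        * indicator {0<..} p * indicator {-1<..<1} m \<partial>lborel \<partial>lborel)"
    by (intro nn_integral_cong) (auto simp: quadrant split: split_indicator)
  finally show ?thesis by (simp add: nn_integral_multc)
qed

section \<open>Characteristic functions, atoms and signs\<close>

lemma integral_char_parseval:
  assumes "real_distribution M" "real_distribution N"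
  shows "(\<integral>y. char N (c * (y - x)) \<partial>M) = (\<integral>t. iexp (- (c * x * t)) * char M (c * t) \<partial>N)"
proof -
  interpret M: real_distribution M by fact
  interpret N: real_distribution N by fact
  interpret pair_sigma_finite M N ..
  interpret MN: prob_space "M \<Otimes>\<^sub>M N"
    by (rule prob_space_pair) unfold_locales
  have "(\<integral>y. char N (c * (y - x)) \<partial>M) = (\<integral>y. \<integral>t. iexp (c * (y - x) * t) \<partial>N \<partial>M)"
    by (simp add: char_def)
  also have "\<dots> = (\<integral>t. \<integral>y. iexp (c * (y - x) * t) \<partial>M \<partial>N)"
    by (rule Fubini_integral[symmetric], rule MN.integrable_const_bound[where B = 1]) auto
  also have "\<dots> = (\<integral>t. iexp (- (c * x * t)) * char M (c * t) \<partial>N)"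
  proof (rule Bochner_Integration.integral_cong[OF refl])
    fix t
    have "iexp (c * (y - x) * t) = iexp (- (c * x * t)) * iexp (c * t * y)" for y
      by (simp add: exp_add[symmetric] algebra_simps)
    then show "(\<integral>y. iexp (c * (y - x) * t) \<partial>M) = iexp (- (c * x * t)) * char M (c * t)"
      by (simp add: char_def)
  qed
  finally show ?thesis .
qed

lemma (in real_distribution) measure_singleton_le_integral_cmod_char:
  "measure M {x} \<le> (\<integral>t. cmod (char M (c * t)) \<partial>std_normal_distribution)"
proof -
  let ?gauss = "\<lambda>y. exp (- (c * (y - x))\<^sup>2 / 2)"
  have "measure M {x} = (\<integral>y. indicator {x} y \<partial>M)" by simp
  also have "\<dots> \<le> (\<integral>y. ?gauss y \<partial>M)"
    by (intro integral_mono integrable_const_bound[where B = 1]) (auto simp: indicator_def)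
  also have "\<dots> = cmod (\<integral>y. char std_normal_distribution (c * (y - x)) \<partial>M)"
    by (simp add: char_std_normal_distribution del: of_real_exp)
  also have "\<dots> = cmod (\<integral>t. iexp (- (c * x * t)) * char M (c * t) \<partial>std_normal_distribution)"
    using real_distribution_axioms real_dist_normal_dist by (simp only: integral_char_parseval)
  also have "\<dots> \<le> (\<integral>t. cmod (iexp (- (c * x * t)) * char M (c * t)) \<partial>std_normal_distribution)"
    by (rule integral_norm_bound)
  finally show ?thesis by (simp add: norm_mult)
qed

lemma (in real_distribution) measure_singleton_eq_0:
  assumes "(char M \<longlongrightarrow> 0) at_infinity"
  shows "measure M {x} = 0"
proof -
  interpret N: real_distribution std_normal_distribution
    by (rule real_dist_normal_dist)
  have "(\<lambda>n. \<integral>t. cmod (char M (real n * t)) \<partial>std_normal_distribution)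
      \<longlonglongrightarrow> (\<integral>t. 0 \<partial>std_normal_distribution)"
  proof (rule integral_dominated_convergence[where w = "\<lambda>_. 1"])
    have "(\<lambda>n. cmod (char M (real n * t))) \<longlonglongrightarrow> 0" if "t \<noteq> 0" for t
    proof -
      have "filterlim (\<lambda>n. t * real n) at_infinity sequentially"
        using that
        by (intro tendsto_mult_filterlim_at_infinity[OF tendsto_const]
          filterlim_real_at_infinity_sequentially)
      from filterlim_compose[OF assms this] show ?thesis
        by (intro tendsto_norm_zero) (simp add: mult.commute)
    qed
    then show "AE t in std_normal_distribution. (\<lambda>n. cmod (char M (real n * t))) \<longlonglongrightarrow> 0"
      using AE_lborel_singleton[of 0] by (auto simp: AE_density)
  qed (auto simp: cmod_char_le_1)
  then have "measure M {x} \<le> 0"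
    by (intro LIMSEQ_le_const) (auto intro: measure_singleton_le_integral_cmod_char)
  then show ?thesis by (simp add: measure_le_0_iff)
qed

text \<open>Cutting \<open>du / u\<close> off near \<open>0\<close> keeps the measure finite, so that Fubini's theorem applies to
  random variables without moments.\<close>

definition reciprocal_measure :: "real \<Rightarrow> real \<Rightarrow> real measure" where
  "reciprocal_measure a c = density lborel (\<lambda>u. ennreal (indicator {a..c} u / u))"

definition truncated_sgn :: "real \<Rightarrow> real \<Rightarrow> real \<Rightarrow> real" where
  "truncated_sgn a c y = (\<integral>u. sin (u * y) \<partial>reciprocal_measure a c)"

lemma sets_reciprocal_measure[simp, measurable_cong]: "sets (reciprocal_measure a c) = sets borel"
  by (simp add: reciprocal_measure_def)

lemma finite_measure_reciprocal_measure:
  assumes "0 < a"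
  shows "finite_measure (reciprocal_measure a c)"
proof (rule finite_measureI)
  have "emeasure (reciprocal_measure a c) (space (reciprocal_measure a c))
      \<le> (\<integral>\<^sup>+u. ennreal (1 / a) * indicator {a..c} u \<partial>lborel)"
    unfolding reciprocal_measure_def using assms
    by (auto simp: emeasure_density intro!: nn_integral_mono frac_le split: split_indicator)
  also have "\<dots> < \<infinity>"
    using emeasure_lborel_Icc_eq[of a c]
    by (simp add: nn_integral_cmult_indicator ennreal_mult_less_top)
  finally show "emeasure (reciprocal_measure a c) (space (reciprocal_measure a c)) \<noteq> \<infinity>" by simp
qed

lemma reciprocal_measure_pair:
  assumes "0 < a"
  shows "reciprocal_measure a c \<Otimes>\<^sub>M reciprocal_measure a c
    = density (lborel \<Otimes>\<^sub>M lborel) (\<lambda>z. ennreal (indicator ({a..c} \<times> {a..c}) z / (fst z * snd z)))"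
proof -
  interpret finite_measure "reciprocal_measure a c"
    using assms by (rule finite_measure_reciprocal_measure)
  have "reciprocal_measure a c \<Otimes>\<^sub>M reciprocal_measure a c
      = density (lborel \<Otimes>\<^sub>M lborel)
        (\<lambda>(u, v). ennreal (indicator {a..c} u / u) * ennreal (indicator {a..c} v / v))"
    using sigma_finite_measure_axioms unfolding reciprocal_measure_def
    by (intro pair_measure_density) (auto simp: lborel.sigma_finite_measure_axioms)
  also have "\<dots> = density (lborel \<Otimes>\<^sub>M lborel)
      (\<lambda>z. ennreal (indicator ({a..c} \<times> {a..c}) z / (fst z * snd z)))"
    using assms
    by (intro density_cong) (auto simp: ennreal_mult[symmetric] indicator_def intro!: AE_I2)
  finally show ?thesis .
qed

lemma borel_measurable_truncated_sgn:
  assumes "0 < a"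
  shows "truncated_sgn a c \<in> borel_measurable borel"
proof -
  interpret finite_measure "reciprocal_measure a c"
    using assms by (rule finite_measure_reciprocal_measure)
  show ?thesis unfolding truncated_sgn_def by measurable
qed

lemma truncated_sgn_eq_Si:
  assumes "0 < a" "a \<le> c"
  shows "truncated_sgn a c y = sgn y * (Si (c * \<bar>y\<bar>) - Si (a * \<bar>y\<bar>))"
proof -
  have integrable: "interval_lebesgue_integrable lborel (min (ereal 0) (min (ereal a) (ereal c)))
      (max (ereal 0) (max (ereal a) (ereal c))) (\<lambda>u. sin (u * y) / u)"
    using assms integrable_sinc'[of c y] by (simp add: min_def max_def)
  have "truncated_sgn a c y = (\<integral>u. (indicator {a..c} u / u) *\<^sub>R sin (u * y) \<partial>lborel)"
    unfolding truncated_sgn_def reciprocal_measure_def using assms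
    by (intro integral_density) (auto split: split_indicator)
  also have "\<dots> = (LBINT u=ereal a..ereal c. sin (u * y) / u)"
    using assms by (simp add: interval_integral_Icc set_lebesgue_integral_def)
  also have "\<dots> = (LBINT u=ereal 0..ereal c. sin (u * y) / u)
      - (LBINT u=ereal 0..ereal a. sin (u * y) / u)"
    using interval_integral_sum[OF integrable] by simp
  also have "\<dots> = sgn y * Si (c * \<bar>y\<bar>) - sgn y * Si (a * \<bar>y\<bar>)"
    using assms LBINT_I0c_sin_scale_divide[of c y] LBINT_I0c_sin_scale_divide[of a y]
    by (simp add: zero_ereal_def)
  finally show ?thesis by (simp add: right_diff_distrib)
qed

lemma truncated_sgn_bounded:
  obtains C where "\<And>a c y. 0 < a \<Longrightarrow> a \<le> c \<Longrightarrow> \<bar>truncated_sgn a c y\<bar> \<le> C"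
proof -
  obtain C where C: "\<And>t. \<bar>Si t\<bar> \<le> C" using bounded_Si by blast
  have "\<bar>truncated_sgn a c y\<bar> \<le> 2 * C" if "0 < a" "a \<le> c" for a c y
  proof -
    have "\<bar>truncated_sgn a c y\<bar> \<le> \<bar>Si (c * \<bar>y\<bar>) - Si (a * \<bar>y\<bar>)\<bar>"
      using that by (simp add: truncated_sgn_eq_Si abs_mult abs_sgn_eq)
    also have "\<dots> \<le> 2 * C"
      using C[of "c * \<bar>y\<bar>"] C[of "a * \<bar>y\<bar>"] by linarith
    finally show ?thesis .
  qed
  then show thesis by (rule that)
qed

lemma truncated_sgn_tendsto:
  assumes a_lim: "filterlim a (at_right 0) F" and c_lim: "filterlim c at_top F"
  shows "((\<lambda>n. truncated_sgn (a n) (c n) y) \<longlongrightarrow> pi / 2 * sgn y) F"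
proof -
  have "\<forall>\<^sub>F n in F. a n \<in> {0<..<1}"
    by (rule eventually_compose_filterlim[OF _ a_lim]) (rule eventually_at_right_real, simp)
  moreover have "\<forall>\<^sub>F n in F. 1 \<le> c n"
    using c_lim by (simp add: filterlim_at_top)
  ultimately have "\<forall>\<^sub>F n in F. sgn y * (Si (c n * \<bar>y\<bar>) - Si (a n * \<bar>y\<bar>))
      = truncated_sgn (a n) (c n) y"
    by eventually_elim (simp add: truncated_sgn_eq_Si)
  moreover have "((\<lambda>n. sgn y * (Si (c n * \<bar>y\<bar>) - Si (a n * \<bar>y\<bar>))) \<longlongrightarrow> pi / 2 * sgn y) F"
  proof (cases "y = 0")
    case False
    have "((\<lambda>n. Si (c n * \<bar>y\<bar>)) \<longlongrightarrow> pi / 2) F"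
      using False
      by (intro filterlim_compose[OF Si_at_top]
        filterlim_at_top_mult_tendsto_pos[OF tendsto_const _ c_lim]) auto
    moreover have "((\<lambda>n. Si (a n * \<bar>y\<bar>)) \<longlongrightarrow> Si (0 * \<bar>y\<bar>)) F"
      using a_lim
      by (intro isCont_tendsto_compose[OF isCont_Si] tendsto_intros) (simp add: filterlim_at)
    ultimately have "((\<lambda>n. sgn y * (Si (c n * \<bar>y\<bar>) - Si (a n * \<bar>y\<bar>)))
        \<longlongrightarrow> sgn y * (pi / 2 - Si (0 * \<bar>y\<bar>))) F"
      by (intro tendsto_intros)
    then show ?thesis by (simp add: Si_def zero_ereal_def mult.commute)
  qed simp
  ultimately show ?thesis by (rule Lim_transform_eventually[rotated])
qed

lemma incseq_Icc_inverse: "incseq (\<lambda>n. {1 / (real n + 1)..real n + 1})"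
proof (rule incseq_SucI)
  fix n
  have "1 / (real (Suc n) + 1) \<le> 1 / (real n + 1)" "real n + 1 \<le> real (Suc n) + 1"
    by (simp_all add: frac_le)
  then show "{1 / (real n + 1)..real n + 1} \<subseteq> {1 / (real (Suc n) + 1)..real (Suc n) + 1}"
    by (auto intro: order_trans)
qed

lemma UN_Icc_inverse: "(\<Union>n. {1 / (real n + 1)..real n + 1}) = {0<..}"
proof (intro equalityI subsetI)
  fix u :: real assume "u \<in> {0<..}"
  moreover obtain n where "max u (1 / u) \<le> real n"
    using real_arch_simple by blast
  ultimately have "u \<in> {1 / (real n + 1)..real n + 1}"
    by (auto simp: field_simps)
  then show "u \<in> (\<Union>n. {1 / (real n + 1)..real n + 1})" by blast
next
  fix u :: real assume "u \<in> (\<Union>n. {1 / (real n + 1)..real n + 1})"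
  then obtain n where "1 / (real n + 1) \<le> u" by auto
  then show "u \<in> {0<..}"
    by (auto intro: less_le_trans[rotated])
qed

lemma incseq_Times_self: "incseq A \<Longrightarrow> incseq (\<lambda>n. A n \<times> A n)"
  by (auto simp: incseq_def)

lemma UN_Times_self:
  assumes "incseq A"
  shows "(\<Union>n. A n \<times> A n) = (\<Union>n. A n) \<times> (\<Union>n. A n)"
proof (intro equalityI subsetI)
  fix z assume "z \<in> (\<Union>n. A n) \<times> (\<Union>n. A n)"
  then obtain m n where "fst z \<in> A m" "snd z \<in> A n" by auto
  then have "z \<in> A (max m n) \<times> A (max m n)"
    using incseqD[OF assms, of m "max m n"] incseqD[OF assms, of n "max m n"]
    by (auto simp: mem_Times_iff)
  then show "z \<in> (\<Union>n. A n \<times> A n)" by blast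
qed auto

context prob_space
begin

lemma
  fixes f g :: "'b \<Rightarrow> 'a \<Rightarrow> real"
  assumes "finite_measure N"
    and [measurable]: "case_prod f \<in> borel_measurable (N \<Otimes>\<^sub>M M)"
      "case_prod g \<in> borel_measurable (N \<Otimes>\<^sub>M M)"
    and bounded: "\<And>u \<omega>. \<bar>f u \<omega>\<bar> \<le> B" "\<And>u \<omega>. \<bar>g u \<omega>\<bar> \<le> B"
  shows integrable_expectation_mult:
      "integrable (N \<Otimes>\<^sub>M N) (\<lambda>z. expectation (\<lambda>\<omega>. f (fst z) \<omega> * g (snd z) \<omega>))" (is ?integrable)
    and expectation_integral_mult_integral:
      "expectation (\<lambda>\<omega>. (\<integral>u. f u \<omega> \<partial>N) * (\<integral>v. g v \<omega> \<partial>N))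
        = (\<integral>z. expectation (\<lambda>\<omega>. f (fst z) \<omega> * g (snd z) \<omega>) \<partial>(N \<Otimes>\<^sub>M N))" (is ?fubini)
proof -
  interpret N: finite_measure N by fact
  interpret N2: pair_sigma_finite N N ..
  interpret NN: finite_measure "N \<Otimes>\<^sub>M N"
    by (rule finite_measure_pair_measure) unfold_locales
  interpret P: pair_sigma_finite M "N \<Otimes>\<^sub>M N" ..
  interpret PF: finite_measure "M \<Otimes>\<^sub>M (N \<Otimes>\<^sub>M N)"
    by (rule finite_measure_pair_measure) unfold_locales
  define F where "F \<omega> z = f (fst z) \<omega> * g (snd z) \<omega>" for \<omega> z
  have [measurable]: "case_prod F \<in> borel_measurable (M \<Otimes>\<^sub>M (N \<Otimes>\<^sub>M N))"
    unfolding F_def by measurable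
  have F_bounded: "\<bar>F \<omega> z\<bar> \<le> B * B" for \<omega> z
    unfolding F_def abs_mult using bounded[of "fst z" \<omega>] bounded[of "snd z" \<omega>]
    by (intro mult_mono) auto
  have F_integrable: "integrable (M \<Otimes>\<^sub>M (N \<Otimes>\<^sub>M N)) (case_prod F)"
    by (rule PF.integrable_const_bound[where B = "B * B"]) (auto simp: F_bounded)
  from P.integrable_snd[OF this] show ?integrable
    by (simp add: F_def)
  have "(\<integral>u. f u \<omega> \<partial>N) * (\<integral>v. g v \<omega> \<partial>N) = (\<integral>z. F \<omega> z \<partial>(N \<Otimes>\<^sub>M N))" if "\<omega> \<in> space M" for \<omega>
  proof -
    have "integrable (N \<Otimes>\<^sub>M N) (F \<omega>)"
      using that by (intro NN.integrable_const_bound[where B = "B * B"]) (auto simp: F_bounded)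
    then have "(\<integral>z. F \<omega> z \<partial>(N \<Otimes>\<^sub>M N)) = (\<integral>u. \<integral>v. F \<omega> (u, v) \<partial>N \<partial>N)"
      by (rule N2.integral_fst'[symmetric])
    then show ?thesis by (simp add: F_def)
  qed
  then have "expectation (\<lambda>\<omega>. (\<integral>u. f u \<omega> \<partial>N) * (\<integral>v. g v \<omega> \<partial>N)) = (\<integral>\<omega>. \<integral>z. F \<omega> z \<partial>(N \<Otimes>\<^sub>M N) \<partial>M)"
    by (intro Bochner_Integration.integral_cong) auto
  also have "\<dots> = (\<integral>z. \<integral>\<omega>. F \<omega> z \<partial>M \<partial>(N \<Otimes>\<^sub>M N))"
    by (rule P.Fubini_integral[symmetric, OF F_integrable])
  finally show ?fubini by (simp add: F_def)
qed

lemma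
  assumes [measurable]: "random_variable borel U" "random_variable borel V"
    and nonneg: "\<And>u v. 0 < u \<Longrightarrow> 0 < v \<Longrightarrow> 0 \<le> expectation (\<lambda>\<omega>. sin (u * U \<omega>) * sin (v * V \<omega>))"
    and "0 < a"
  shows expectation_truncated_sgn_mult_nonneg:
      "0 \<le> expectation (\<lambda>\<omega>. truncated_sgn a c (U \<omega>) * truncated_sgn a c (V \<omega>))" (is "0 \<le> ?E")
    and ennreal_expectation_truncated_sgn_mult:
      "ennreal (expectation (\<lambda>\<omega>. truncated_sgn a c (U \<omega>) * truncated_sgn a c (V \<omega>)))
        = (\<integral>\<^sup>+z\<in>{a..c} \<times> {a..c}. ennreal (expectation (\<lambda>\<omega>. sin (fst z * U \<omega>) * sin (snd z * V \<omega>))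
            / (fst z * snd z)) \<partial>(lborel \<Otimes>\<^sub>M lborel))"
proof -
  let ?N = "reciprocal_measure a c"
  let ?H = "\<lambda>z. expectation (\<lambda>\<omega>. sin (fst z * U \<omega>) * sin (snd z * V \<omega>))"
  interpret N: finite_measure ?N
    using \<open>0 < a\<close> by (rule finite_measure_reciprocal_measure)
  have expectation_eq: "?E = (\<integral>z. ?H z \<partial>(?N \<Otimes>\<^sub>M ?N))"
    unfolding truncated_sgn_def
    by (rule expectation_integral_mult_integral[OF N.finite_measure_axioms, where B = 1]) auto
  have H_integrable: "integrable (?N \<Otimes>\<^sub>M ?N) ?H"
    by (rule integrable_expectation_mult[OF N.finite_measure_axioms, where B = 1]) auto
  have H_nonneg: "AE z in ?N \<Otimes>\<^sub>M ?N. 0 \<le> ?H z"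
    unfolding reciprocal_measure_pair[OF \<open>0 < a\<close>] using \<open>0 < a\<close>
    by (subst AE_density) (auto intro!: nonneg split: split_indicator)
  then show "0 \<le> ?E"
    unfolding expectation_eq by (rule integral_nonneg_AE)
  have "ennreal ?E = (\<integral>\<^sup>+z. ennreal (?H z) \<partial>(?N \<Otimes>\<^sub>M ?N))"
    unfolding expectation_eq by (rule nn_integral_eq_integral[OF H_integrable H_nonneg, symmetric])
  also have "\<dots> = (\<integral>\<^sup>+z. ennreal (indicator ({a..c} \<times> {a..c}) z / (fst z * snd z)) * ennreal (?H z)
      \<partial>(lborel \<Otimes>\<^sub>M lborel))"
    unfolding reciprocal_measure_pair[OF \<open>0 < a\<close>] by (rule nn_integral_density) measurable
  also have "\<dots> = (\<integral>\<^sup>+z\<in>{a..c} \<times> {a..c}. ennreal (?H z / (fst z * snd z)) \<partial>(lborel \<Otimes>\<^sub>M lborel))"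
    using \<open>0 < a\<close>
    by (intro nn_integral_cong) (auto simp: ennreal_mult'[symmetric] split: split_indicator)
  finally show "ennreal ?E = \<dots>" .
qed

lemma expectation_truncated_sgn_mult_tendsto:
  assumes [measurable]: "random_variable borel U" "random_variable borel V"
    and pos: "\<And>n. 0 < a n" and ordered: "\<And>n. a n \<le> c n"
    and lims: "filterlim a (at_right 0) sequentially" "filterlim c at_top sequentially"
  shows "(\<lambda>n. expectation (\<lambda>\<omega>. truncated_sgn (a n) (c n) (U \<omega>) * truncated_sgn (a n) (c n) (V \<omega>)))
    \<longlonglongrightarrow> pi\<^sup>2 / 4 * expectation (\<lambda>\<omega>. sgn (U \<omega>) * sgn (V \<omega>))"
proof -
  obtain C where C: "\<And>a c y. 0 < a \<Longrightarrow> a \<le> c \<Longrightarrow> \<bar>truncated_sgn a c y\<bar> \<le> C"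
    using truncated_sgn_bounded by blast
  have [measurable]: "truncated_sgn (a n) (c n) \<in> borel_measurable borel" for n
    using pos by (rule borel_measurable_truncated_sgn)
  have "(\<lambda>n. expectation (\<lambda>\<omega>. truncated_sgn (a n) (c n) (U \<omega>) * truncated_sgn (a n) (c n) (V \<omega>)))
    \<longlonglongrightarrow> expectation (\<lambda>\<omega>. (pi / 2 * sgn (U \<omega>)) * (pi / 2 * sgn (V \<omega>)))"
  proof (rule integral_dominated_convergence[where w = "\<lambda>_. C * C"])
    have "0 \<le> C" using C[of 1 1 0] by linarith
    then show "AE \<omega> in M. norm (truncated_sgn (a n) (c n) (U \<omega>) * truncated_sgn (a n) (c n) (V \<omega>))
        \<le> C * C" for n
      unfolding real_norm_def abs_mult by (intro AE_I2 mult_mono C pos ordered) auto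
    show "AE \<omega> in M. (\<lambda>n. truncated_sgn (a n) (c n) (U \<omega>) * truncated_sgn (a n) (c n) (V \<omega>))
        \<longlonglongrightarrow> (pi / 2 * sgn (U \<omega>)) * (pi / 2 * sgn (V \<omega>))"
      by (intro AE_I2 tendsto_mult truncated_sgn_tendsto lims)
  qed auto
  also have "(\<lambda>\<omega>. (pi / 2 * sgn (U \<omega>)) * (pi / 2 * sgn (V \<omega>)))
      = (\<lambda>\<omega>. pi\<^sup>2 / 4 * (sgn (U \<omega>) * sgn (V \<omega>)))"
    by (simp add: power2_eq_square mult_ac)
  finally show ?thesis by simp
qed

lemma
  assumes [measurable]: "random_variable borel U" "random_variable borel V"
    and nonneg: "\<And>u v. 0 < u \<Longrightarrow> 0 < v \<Longrightarrow> 0 \<le> expectation (\<lambda>\<omega>. sin (u * U \<omega>) * sin (v * V \<omega>))"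
  shows expectation_sgn_mult_sgn_nonneg: "0 \<le> expectation (\<lambda>\<omega>. sgn (U \<omega>) * sgn (V \<omega>))" (is "0 \<le> ?E")
    and ennreal_expectation_sgn_mult_sgn:
      "ennreal (pi\<^sup>2 / 4 * expectation (\<lambda>\<omega>. sgn (U \<omega>) * sgn (V \<omega>)))
        = (\<integral>\<^sup>+z\<in>{0<..} \<times> {0<..}. ennreal (expectation (\<lambda>\<omega>. sin (fst z * U \<omega>) * sin (snd z * V \<omega>))
            / (fst z * snd z)) \<partial>(lborel \<Otimes>\<^sub>M lborel))"
proof -
  let ?H = "\<lambda>z. ennreal (expectation (\<lambda>\<omega>. sin (fst z * U \<omega>) * sin (snd z * V \<omega>)) / (fst z * snd z))"
  let ?a = "\<lambda>n. 1 / (real n + 1)" and ?c = "\<lambda>n. real n + 1"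
  let ?K = "\<lambda>n \<omega>. truncated_sgn (?a n) (?c n) (U \<omega>) * truncated_sgn (?a n) (?c n) (V \<omega>)"
  have "filterlim ?a (at_right 0) sequentially" "filterlim ?c at_top sequentially"
    by real_asymp+
  then have lim: "(\<lambda>n. expectation (?K n)) \<longlonglongrightarrow> pi\<^sup>2 / 4 * ?E"
    by (intro expectation_truncated_sgn_mult_tendsto) (auto simp: field_simps)
  then have "0 \<le> pi\<^sup>2 / 4 * ?E"
    by (rule LIMSEQ_le_const) (auto intro!: expectation_truncated_sgn_mult_nonneg nonneg)
  then show "0 \<le> ?E" by (simp add: zero_le_mult_iff)
  define D where "D = density (lborel \<Otimes>\<^sub>M lborel) ?H"
  have D: "emeasure D X = (\<integral>\<^sup>+z\<in>X. ?H z \<partial>(lborel \<Otimes>\<^sub>M lborel))" if "X \<in> sets (borel \<Otimes>\<^sub>M borel)" for X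
    unfolding D_def using that by (intro emeasure_density) auto
  have "(\<lambda>n. emeasure D ({?a n..?c n} \<times> {?a n..?c n})) \<longlonglongrightarrow> emeasure D ({0<..} \<times> {0<..})"
    unfolding UN_Icc_inverse[symmetric] UN_Times_self[OF incseq_Icc_inverse, symmetric]
    by (rule Lim_emeasure_incseq[OF _ incseq_Times_self[OF incseq_Icc_inverse]]) (auto simp: D_def)
  moreover have "emeasure D ({?a n..?c n} \<times> {?a n..?c n}) = ennreal (expectation (?K n))" for n
    by (simp add: D ennreal_expectation_truncated_sgn_mult nonneg)
  ultimately have "(\<lambda>n. ennreal (expectation (?K n))) \<longlonglongrightarrow> emeasure D ({0<..} \<times> {0<..})"
    by simp
  with tendsto_ennrealI[OF lim] have "ennreal (pi\<^sup>2 / 4 * ?E) = emeasure D ({0<..} \<times> {0<..})"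
    by (rule LIMSEQ_unique)
  then show "ennreal (pi\<^sup>2 / 4 * ?E) = (\<integral>\<^sup>+z\<in>{0<..} \<times> {0<..}. ?H z \<partial>(lborel \<Otimes>\<^sub>M lborel))"
    by (simp add: D)
qed

end

section \<open>Symmetric stable laws\<close>

definition symmetric_stable :: "real \<Rightarrow> real \<Rightarrow> real measure \<Rightarrow> bool" where
  "symmetric_stable \<alpha> \<gamma> \<mu> \<longleftrightarrow> (\<forall>t. char \<mu> t = complex_of_real (exp (- (\<gamma> * \<bar>t\<bar> powr \<alpha>))))"

lemma symmetric_stable_unique:
  assumes "real_distribution \<mu>" "real_distribution \<nu>" "symmetric_stable \<alpha> \<gamma> \<mu>"
    "symmetric_stable \<alpha> \<gamma> \<nu>"
  shows "\<mu> = \<nu>"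
  using assms by (intro Levy_uniqueness) (auto simp: symmetric_stable_def)

lemma (in real_distribution) measure_singleton_symmetric_stable:
  assumes "symmetric_stable \<alpha> \<gamma> M" "0 < \<alpha>" "0 < \<gamma>"
  shows "measure M {x} = 0"
proof (rule measure_singleton_eq_0)
  have "((\<lambda>y. exp (- (\<gamma> * y powr \<alpha>))) \<longlongrightarrow> 0) at_top"
    using assms(2,3) by real_asymp
  then have "((\<lambda>t. exp (- (\<gamma> * norm t powr \<alpha>))) \<longlongrightarrow> 0) (at_infinity :: real filter)"
    by (rule filterlim_compose) (rule filterlim_norm_at_top)
  moreover have "cmod (char M t) = exp (- (\<gamma> * norm t powr \<alpha>))" for t
    using assms(1) by (simp add: symmetric_stable_def del: of_real_exp)
  ultimately show "(char M \<longlongrightarrow> 0) at_infinity"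
    by (subst tendsto_norm_zero_iff[symmetric]) simp
qed

context prob_space
begin

lemma AE_neq_of_symmetric_stable:
  assumes [measurable]: "random_variable borel X"
    and "symmetric_stable \<alpha> \<gamma> (distr M borel X)" "0 < \<alpha>" "0 < \<gamma>"
  shows "AE \<omega> in M. X \<omega> \<noteq> x"
proof -
  interpret X: real_distribution "distr M borel X"
    by (rule real_distribution_distr) measurable
  have "measure (distr M borel X) {x} = 0"
    using assms(2-4) by (rule X.measure_singleton_symmetric_stable)
  then have "AE y in distr M borel X. y \<notin> {x}"
    by (simp add: X.prob_eq_0)
  then show ?thesis by (subst (asm) AE_distr_iff) auto
qed

lemma symmetric_stable_distr_cmult:
  assumes [measurable]: "random_variable borel X" and "symmetric_stable \<alpha> \<gamma> (distr M borel X)"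
  shows "symmetric_stable \<alpha> (\<bar>c\<bar> powr \<alpha> * \<gamma>) (distr M borel (\<lambda>\<omega>. c * X \<omega>))"
proof -
  have "char (distr M borel (\<lambda>\<omega>. c * X \<omega>)) t = char (distr M borel X) (c * t)" for t
    by (simp add: char_def integral_distr mult_ac)
  then show ?thesis
    using assms(2) by (simp add: symmetric_stable_def abs_mult powr_mult mult_ac)
qed

lemma symmetric_stable_distr_add:
  assumes "indep_var borel X borel Y"
    and "symmetric_stable \<alpha> \<gamma> (distr M borel X)" "symmetric_stable \<alpha> \<delta> (distr M borel Y)"
  shows "symmetric_stable \<alpha> (\<gamma> + \<delta>) (distr M borel (\<lambda>\<omega>. X \<omega> + Y \<omega>))"
  using assms
  by (simp add: symmetric_stable_def char_distr_add distrib_right exp_add[symmetric]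
    flip: of_real_mult)

lemma symmetric_stable_distr_sum:
  assumes "finite I" "indep_vars (\<lambda>_. borel) X I"
    and "\<And>k. k \<in> I \<Longrightarrow> symmetric_stable \<alpha> (\<gamma> k) (distr M borel (X k))"
  shows "symmetric_stable \<alpha> (\<Sum>k\<in>I. \<gamma> k) (distr M borel (\<lambda>\<omega>. \<Sum>k\<in>I. X k \<omega>))"
  unfolding symmetric_stable_def
proof
  fix t
  have "char (distr M borel (\<lambda>\<omega>. \<Sum>k\<in>I. X k \<omega>)) t
      = (\<Prod>k\<in>I. complex_of_real (exp (- (\<gamma> k * \<bar>t\<bar> powr \<alpha>))))"
    using assms(3) by (simp only: char_distr_sum[OF assms(2)]) (simp add: symmetric_stable_def)
  also have "\<dots> = complex_of_real (exp (\<Sum>k\<in>I. - (\<gamma> k * \<bar>t\<bar> powr \<alpha>)))"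
    using assms(1) by (simp only: exp_sum of_real_prod)
  finally show "char (distr M borel (\<lambda>\<omega>. \<Sum>k\<in>I. X k \<omega>)) t
      = complex_of_real (exp (- ((\<Sum>k\<in>I. \<gamma> k) * \<bar>t\<bar> powr \<alpha>)))"
    by (simp add: sum_negf sum_distrib_right)
qed

end

section \<open>The ratio of two independent stable variables\<close>

definition sine_kernel :: "real \<Rightarrow> real \<Rightarrow> real \<Rightarrow> real \<Rightarrow> real" where
  "sine_kernel \<alpha> T u v = (exp (- (\<bar>u - v\<bar> powr \<alpha> + T * \<bar>u + v\<bar> powr \<alpha>))
    - exp (- (\<bar>u + v\<bar> powr \<alpha> + T * \<bar>u - v\<bar> powr \<alpha>))) / 2"

definition ratio_kernel :: "real \<Rightarrow> real \<Rightarrow> real \<Rightarrow> real" where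
  "ratio_kernel \<alpha> T m = ln ((1 + T * \<bar>m\<bar> powr - \<alpha>) / (1 + T * \<bar>m\<bar> powr \<alpha>)) / (1 - m\<^sup>2)"

definition ratio_tail_kernel :: "real \<Rightarrow> real \<Rightarrow> real \<Rightarrow> real" where
  "ratio_tail_kernel \<alpha> T m = ln ((1 + T * \<bar>m\<bar> powr \<alpha>) / (\<bar>m\<bar> powr \<alpha> + T)) / (1 - m\<^sup>2)"

lemma borel_measurable_sine_kernel[measurable]:
  "case_prod (sine_kernel \<alpha> T) \<in> borel_measurable (borel \<Otimes>\<^sub>M borel)"
  unfolding sine_kernel_def by measurable

lemma borel_measurable_ratio_kernel[measurable]: "ratio_kernel \<alpha> T \<in> borel_measurable borel"
  and borel_measurable_ratio_tail_kernel[measurable]: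
    "ratio_tail_kernel \<alpha> T \<in> borel_measurable borel"
  unfolding ratio_kernel_def ratio_tail_kernel_def by measurable

lemma add_le_one_add_mult:
  fixes q T :: "'a :: linordered_idom"
  assumes "q \<le> 1" "T \<le> 1"
  shows "q + T \<le> 1 + T * q"
proof -
  have "0 \<le> (1 - T) * (1 - q)" using assms by simp
  then show ?thesis by (simp add: algebra_simps)
qed

lemma sine_kernel_nonneg:
  assumes "0 < \<alpha>" "0 \<le> T" "T \<le> 1" "0 \<le> u" "0 \<le> v"
  shows "0 \<le> sine_kernel \<alpha> T u v"
proof -
  have "\<bar>u - v\<bar> powr \<alpha> \<le> \<bar>u + v\<bar> powr \<alpha>"
    using assms by (intro powr_mono2) auto
  then have "0 \<le> (1 - T) * (\<bar>u + v\<bar> powr \<alpha> - \<bar>u - v\<bar> powr \<alpha>)"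
    using assms by simp
  then show ?thesis by (simp add: sine_kernel_def algebra_simps)
qed

lemma sine_kernel_sum_ratio:
  assumes "0 < p" "-1 < m" "m < 1"
  shows "sine_kernel \<alpha> T (p * (1 + m) / 2) (p * (1 - m) / 2)
        / ((p * (1 + m) / 2) * (p * (1 - m) / 2)) * (p / 2)
    = (exp (- ((\<bar>m\<bar> powr \<alpha> + T) * p powr \<alpha>)) - exp (- ((1 + T * \<bar>m\<bar> powr \<alpha>) * p powr \<alpha>)))
      / p / (1 - m\<^sup>2)"
proof -
  have "0 < 1 - m\<^sup>2"
    using assms by (simp add: abs_square_less_1)
  have args: "p * (1 + m) / 2 - p * (1 - m) / 2 = p * m" "p * (1 + m) / 2 + p * (1 - m) / 2 = p"
      "(p * (1 + m) / 2) * (p * (1 - m) / 2) = p * p * (1 - m\<^sup>2) / 4"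
    by (simp_all add: field_simps power2_eq_square)
  have "\<bar>p * m\<bar> powr \<alpha> = p powr \<alpha> * \<bar>m\<bar> powr \<alpha>"
    using assms by (simp add: abs_mult powr_mult)
  then have "sine_kernel \<alpha> T (p * (1 + m) / 2) (p * (1 - m) / 2)
      = (exp (- ((\<bar>m\<bar> powr \<alpha> + T) * p powr \<alpha>)) - exp (- ((1 + T * \<bar>m\<bar> powr \<alpha>) * p powr \<alpha>))) / 2"
    unfolding sine_kernel_def args using assms by (simp add: algebra_simps)
  moreover have "N / 2 / (p * p * d / 4) * (p / 2) = N / p / d" if "0 < d" for N d
    using that assms by (simp add: field_simps)
  ultimately show ?thesis
    using \<open>0 < 1 - m\<^sup>2\<close> by (simp only: args(3))
qed

lemma nn_integral_sine_kernel_radial: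
  assumes "0 < \<alpha>" "0 < T" "T \<le> 1" "-1 < m" "m < 1"
  shows "(\<integral>\<^sup>+p\<in>{0<..}. ennreal (sine_kernel \<alpha> T (p * (1 + m) / 2) (p * (1 - m) / 2)
        / ((p * (1 + m) / 2) * (p * (1 - m) / 2))) * ennreal (p / 2) \<partial>lborel)
    = ennreal (1 / \<alpha>) * ennreal (ratio_tail_kernel \<alpha> T m)" (is "?lhs = _")
proof -
  define A B where "A = \<bar>m\<bar> powr \<alpha> + T" and "B = 1 + T * \<bar>m\<bar> powr \<alpha>"
  have "0 < A" using assms by (simp add: A_def add_nonneg_pos)
  have "A \<le> B"
    using assms by (auto simp: A_def B_def intro!: add_le_one_add_mult powr_le1)
  have weight_pos: "0 < 1 - m\<^sup>2"
    using assms by (simp add: abs_square_less_1)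
  have "ennreal (sine_kernel \<alpha> T (p * (1 + m) / 2) (p * (1 - m) / 2)
        / ((p * (1 + m) / 2) * (p * (1 - m) / 2))) * ennreal (p / 2)
      = ennreal ((exp (- (A * p powr \<alpha>)) - exp (- (B * p powr \<alpha>))) / p) * ennreal (1 / (1 - m\<^sup>2))"
    if "0 < p" for p
    unfolding A_def B_def using that weight_pos
    by (subst (1 2) ennreal_mult''[symmetric])
      (simp_all only: sine_kernel_sum_ratio assms, simp_all)
  then have "?lhs = (\<integral>\<^sup>+p\<in>{0<..}. ennreal ((exp (- (A * p powr \<alpha>)) - exp (- (B * p powr \<alpha>))) / p)
      * ennreal (1 / (1 - m\<^sup>2)) \<partial>lborel)"
    by (intro set_nn_integral_cong) auto
  also have "\<dots> = (\<integral>\<^sup>+p. ennreal (1 / (1 - m\<^sup>2))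
      * (ennreal ((exp (- (A * p powr \<alpha>)) - exp (- (B * p powr \<alpha>))) / p)
      * indicator {0<..} p) \<partial>lborel)"
    by (simp only: mult_ac)
  also have "\<dots> = ennreal (1 / (1 - m\<^sup>2)) * ennreal (ln (B / A) / \<alpha>)"
    using assms \<open>0 < A\<close> \<open>A \<le> B\<close> by (simp add: nn_integral_cmult nn_integral_frullani_stretched_exp)
  also have "\<dots> = ennreal (1 / \<alpha>) * ennreal (ratio_tail_kernel \<alpha> T m)"
    using assms weight_pos \<open>0 < A\<close> \<open>A \<le> B\<close>
    by (simp add: ratio_tail_kernel_def A_def[symmetric] B_def[symmetric] ennreal_mult'[symmetric]
      mult.commute)
  finally show ?thesis .
qed

lemma nn_integral_sine_kernel:
  assumes "0 < \<alpha>" "0 < T" "T \<le> 1"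
  shows "(\<integral>\<^sup>+z\<in>{0<..} \<times> {0<..}. ennreal (sine_kernel \<alpha> T (fst z) (snd z) / (fst z * snd z))
      \<partial>(lborel \<Otimes>\<^sub>M lborel))
    = ennreal (2 / \<alpha>) * (\<integral>\<^sup>+m\<in>{0<..<1}. ennreal (ratio_tail_kernel \<alpha> T m) \<partial>lborel)"
    (is "?lhs = _ * ?R")
proof -
  let ?k = "\<lambda>m. ennreal (ratio_tail_kernel \<alpha> T m) * indicator {-1<..<1} m"
  have "?lhs = (\<integral>\<^sup>+m\<in>{-1<..<1}. (\<integral>\<^sup>+p\<in>{0<..}.
      ennreal (sine_kernel \<alpha> T (p * (1 + m) / 2) (p * (1 - m) / 2)
        / ((p * (1 + m) / 2) * (p * (1 - m) / 2))) * ennreal (p / 2) \<partial>lborel) \<partial>lborel)"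
    by (subst nn_integral_quadrant_sum_ratio) (simp_all only: fst_conv snd_conv, measurable)
  also have "\<dots> = (\<integral>\<^sup>+m\<in>{-1<..<1}. ennreal (1 / \<alpha>) * ennreal (ratio_tail_kernel \<alpha> T m) \<partial>lborel)"
    by (intro set_nn_integral_cong refl nn_integral_sine_kernel_radial assms) auto
  also have "\<dots> = (\<integral>\<^sup>+m. ennreal (1 / \<alpha>) * ?k m \<partial>lborel)"
    by (simp only: mult.assoc)
  also have "\<dots> = ennreal (1 / \<alpha>) * (\<integral>\<^sup>+m. ?k m \<partial>lborel)"
    by (rule nn_integral_cmult) measurable
  also have "(\<integral>\<^sup>+m. ?k m \<partial>lborel) = 2 * (\<integral>\<^sup>+m\<in>{0<..}. ?k m \<partial>lborel)"
    by (rule nn_integral_lborel_even) (auto simp: ratio_tail_kernel_def indicator_def)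
  also have "(\<integral>\<^sup>+m\<in>{0<..}. ?k m \<partial>lborel) = ?R"
    by (intro nn_integral_cong) (auto simp: indicator_def)
  also have "ennreal (1 / \<alpha>) * (2 * ?R) = ennreal (2 / \<alpha>) * ?R"
    using assms by (simp add: mult.assoc[symmetric] ennreal_mult'[symmetric] flip: ennreal_numeral)
  finally show ?thesis .
qed

lemma powr_le_powr_uminus:
  fixes \<alpha> m :: real
  assumes "0 \<le> \<alpha>" "0 < m" "m < 1"
  shows "m powr \<alpha> \<le> m powr - \<alpha>"
  using assms by (intro powr_mono') auto

lemma ratio_kernel_nonneg:
  assumes "0 \<le> \<alpha>" "0 \<le> T" "0 < m" "m < 1"
  shows "0 \<le> ratio_kernel \<alpha> T m"
proof -
  have "T * m powr \<alpha> \<le> T * m powr - \<alpha>"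
    using assms by (intro mult_left_mono powr_le_powr_uminus)
  moreover have "0 < 1 - m\<^sup>2"
    using assms by (simp add: power_less_one_iff)
  ultimately show ?thesis
    using assms by (auto simp: ratio_kernel_def add_pos_nonneg intro!: divide_nonneg_pos ln_ge_zero)
qed

lemma ratio_tail_kernel_nonneg:
  assumes "0 \<le> \<alpha>" "0 \<le> T" "T \<le> 1" "0 < m" "m < 1"
  shows "0 \<le> ratio_tail_kernel \<alpha> T m"
proof -
  have "m powr \<alpha> + T \<le> 1 + T * m powr \<alpha>"
    using assms by (intro add_le_one_add_mult powr_le1) auto
  moreover have "0 < 1 - m\<^sup>2"
    using assms by (simp add: power_less_one_iff)
  ultimately show ?thesis
    using assms by (auto simp: ratio_tail_kernel_def add_pos_nonneg
      intro!: divide_nonneg_pos ln_ge_zero)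
qed

lemma ratio_tail_kernel_add_ratio_kernel:
  assumes "0 \<le> T" "0 < m"
  shows "ratio_tail_kernel \<alpha> T m + ratio_kernel \<alpha> T m = \<alpha> * (- ln m / (1 - m\<^sup>2))"
proof -
  define q where "q = m powr \<alpha>"
  have q_pos: "0 < q" and q_inverse: "m powr - \<alpha> = 1 / q" and ln_q: "ln q = \<alpha> * ln m"
    using assms by (simp_all add: q_def powr_minus_divide ln_powr)
  have "0 < 1 + T * q" "0 < q + T"
    using q_pos assms by (simp_all add: add_pos_nonneg)
  moreover have "1 + T * (1 / q) = (q + T) / q"
    using q_pos by (simp add: field_simps)
  ultimately have "ln ((1 + T * q) / (q + T)) + ln ((1 + T * (1 / q)) / (1 + T * q)) = - ln q"
    using q_pos by (simp add: ln_div ln_mult)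
  then show ?thesis
    using assms by (simp add: ratio_tail_kernel_def ratio_kernel_def q_inverse ln_q q_def[symmetric]
      flip: add_divide_distrib)
qed

lemma nn_integral_ratio_kernels_add:
  assumes "0 \<le> \<alpha>" "0 \<le> T" "T \<le> 1"
  shows "(\<integral>\<^sup>+m\<in>{0<..<1}. ennreal (ratio_tail_kernel \<alpha> T m) \<partial>lborel)
      + (\<integral>\<^sup>+m\<in>{0<..<1}. ennreal (ratio_kernel \<alpha> T m) \<partial>lborel) = ennreal (\<alpha> * (pi\<^sup>2 / 8))"
proof -
  have "(\<integral>\<^sup>+m\<in>{0<..<1}. ennreal (ratio_tail_kernel \<alpha> T m) \<partial>lborel)
      + (\<integral>\<^sup>+m\<in>{0<..<1}. ennreal (ratio_kernel \<alpha> T m) \<partial>lborel)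
    = (\<integral>\<^sup>+m. ennreal (ratio_tail_kernel \<alpha> T m) * indicator {0<..<1} m
        + ennreal (ratio_kernel \<alpha> T m) * indicator {0<..<1} m \<partial>lborel)"
    by (rule nn_integral_add[symmetric]) measurable
  also have "\<dots> = (\<integral>\<^sup>+m. ennreal \<alpha> * (ennreal (- ln m / (1 - m\<^sup>2)) * indicator {0<..<1} m) \<partial>lborel)"
    using assms
    by (intro nn_integral_cong)
      (auto simp: ratio_tail_kernel_add_ratio_kernel ratio_tail_kernel_nonneg ratio_kernel_nonneg
        simp flip: ennreal_plus ennreal_mult' split: split_indicator)
  also have "\<dots> = ennreal \<alpha> * ennreal (pi\<^sup>2 / 8)"
    by (subst nn_integral_cmult) (measurable, simp only: nn_integral_neg_ln_weight)
  finally show ?thesis by (simp only: ennreal_mult'[OF assms(1)])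
qed

lemma ln_ratio_star_shaped:
  fixes P Q t :: real
  assumes "0 \<le> Q" "Q \<le> P" "0 \<le> t" "t \<le> 1"
  shows "t * ln ((1 + P) / (1 + Q)) \<le> ln ((1 + t * P) / (1 + t * Q))"
proof -
  define r where "r = (1 + P) / (1 + Q)"
  have "1 \<le> r" using assms by (simp add: r_def)
  have "0 < 1 + t * Q"
    using assms by (simp add: add_pos_nonneg)
  have "t * ln r = (1 - t) * ln 1 + t * ln r" by simp
  also have "\<dots> \<le> ln ((1 - t) * 1 + t * r)"
    using concave_onD[OF ln_concave, of t 1 r] assms \<open>1 \<le> r\<close> by simp
  also have "\<dots> \<le> ln ((1 + t * P) / (1 + t * Q))"
  proof (rule ln_mono)
    have "(1 - t) * 1 + t * r = 1 + t * (P - Q) / (1 + Q)"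
      using assms by (simp add: r_def field_simps)
    also have "\<dots> \<le> 1 + t * (P - Q) / (1 + t * Q)"
      using assms mult_left_le_one_le[of Q t] \<open>0 < 1 + t * Q\<close>
      by (intro add_left_mono divide_left_mono) auto
    also have "\<dots> = (1 + t * P) / (1 + t * Q)"
      using \<open>0 < 1 + t * Q\<close> by (simp add: field_simps)
    finally show "(1 - t) * 1 + t * r \<le> (1 + t * P) / (1 + t * Q)" .
    have "0 \<le> t * (r - 1)" using \<open>1 \<le> r\<close> assms by simp
    then show "0 < (1 - t) * 1 + t * r" by (simp add: algebra_simps)
  qed
  finally show ?thesis by (simp add: r_def)
qed

lemma ratio_kernel_star_shaped:
  assumes "0 \<le> \<alpha>" "0 \<le> T" "0 \<le> t" "t \<le> 1" "0 < m" "m < 1"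
  shows "t * ratio_kernel \<alpha> T m \<le> ratio_kernel \<alpha> (t * T) m"
proof -
  have "T * m powr \<alpha> \<le> T * m powr - \<alpha>"
    using assms by (intro mult_left_mono powr_le_powr_uminus)
  then have "t * ln ((1 + T * m powr - \<alpha>) / (1 + T * m powr \<alpha>))
      \<le> ln ((1 + t * T * m powr - \<alpha>) / (1 + t * T * m powr \<alpha>))"
    using ln_ratio_star_shaped[of "T * m powr \<alpha>" "T * m powr - \<alpha>" t] assms by (simp add: mult.assoc)
  moreover have "0 < 1 - m\<^sup>2"
    using assms by (simp add: power_less_one_iff)
  ultimately show ?thesis
    using assms by (simp add: ratio_kernel_def divide_right_mono)
qed

lemma ln_ratio_le_diff:
  fixes P Q :: real
  assumes "0 \<le> Q" "Q \<le> P"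
  shows "ln ((1 + P) / (1 + Q)) \<le> P - Q"
proof -
  have "ln ((1 + P) / (1 + Q)) \<le> (1 + P) / (1 + Q) - 1"
    using assms by (intro ln_le_minus_one) auto
  also have "\<dots> = (P - Q) / (1 + Q)"
    using assms by (simp add: field_simps)
  also have "\<dots> \<le> (P - Q) / 1"
    using assms by (intro divide_left_mono) auto
  finally show ?thesis by simp
qed

lemma ratio_kernel_le:
  assumes "0 \<le> \<alpha>" "0 \<le> T" "0 < m" "m < 1"
  shows "ratio_kernel \<alpha> T m \<le> 2 * \<alpha> * T * (- ln m * m powr - \<alpha> / (1 - m\<^sup>2))"
proof -
  define q where "q = m powr \<alpha>"
  have q_pos: "0 < q" and q_inverse: "m powr - \<alpha> = 1 / q" and ln_q: "ln q = \<alpha> * ln m"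
    using assms by (simp_all add: q_def powr_minus_divide ln_powr)
  have "1 - q\<^sup>2 \<le> - ln (q\<^sup>2)"
    using ln_le_minus_one[of "q\<^sup>2"] q_pos by simp
  then have "1 - q\<^sup>2 \<le> - 2 * \<alpha> * ln m"
    using q_pos by (simp add: ln_realpow ln_q)
  have "T * m powr \<alpha> \<le> T * m powr - \<alpha>"
    using assms by (intro mult_left_mono powr_le_powr_uminus)
  then have "ln ((1 + T * (1 / q)) / (1 + T * q)) \<le> T * (1 / q) - T * q"
    using assms unfolding q_inverse q_def[symmetric]
    by (intro ln_ratio_le_diff) (auto simp: q_pos less_imp_le)
  also have "\<dots> = T / q * (1 - q\<^sup>2)"
    using q_pos by (simp add: field_simps power2_eq_square)
  also have "\<dots> \<le> T / q * (- 2 * \<alpha> * ln m)"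
    using assms q_pos \<open>1 - q\<^sup>2 \<le> - 2 * \<alpha> * ln m\<close> by (intro mult_left_mono) auto
  finally have "ln ((1 + T * (1 / q)) / (1 + T * q)) / (1 - m\<^sup>2)
      \<le> T / q * (- 2 * \<alpha> * ln m) / (1 - m\<^sup>2)"
    using assms by (intro divide_right_mono) (auto simp: power_le_one_iff)
  then show ?thesis
    using assms by (simp add: ratio_kernel_def q_inverse q_def[symmetric] mult_ac)
qed

lemma nn_integral_ratio_kernel_le:
  assumes "0 \<le> \<alpha>" "\<alpha> < 1" "0 \<le> T"
  shows "(\<integral>\<^sup>+m\<in>{0<..<1}. ennreal (ratio_kernel \<alpha> T m) \<partial>lborel)
      \<le> ennreal (\<alpha> * pi\<^sup>2 / 4 * (T / (1 - \<alpha>)\<^sup>2))"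
proof -
  have "(\<integral>\<^sup>+m\<in>{0<..<1}. ennreal (ratio_kernel \<alpha> T m) \<partial>lborel)
      \<le> (\<integral>\<^sup>+m. ennreal (2 * \<alpha> * T)
        * (ennreal (- ln m * m powr - \<alpha> / (1 - m\<^sup>2)) * indicator {0<..<1} m) \<partial>lborel)"
    using assms
    by (intro nn_integral_mono)
      (auto simp: ennreal_mult'[symmetric] split: split_indicator
        intro!: ennreal_leI ratio_kernel_le[simplified])
  also have "\<dots> = ennreal (2 * \<alpha> * T)
      * (\<integral>\<^sup>+m\<in>{0<..<1}. ennreal (- ln m * m powr - \<alpha> / (1 - m\<^sup>2)) \<partial>lborel)"
    by (rule nn_integral_cmult) measurable
  also have "\<dots> \<le> ennreal (2 * \<alpha> * T) * ennreal (1 / (1 - \<alpha>)\<^sup>2 * (pi\<^sup>2 / 8))"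
    using assms by (intro mult_left_mono nn_integral_neg_ln_powr_weight_le) auto
  also have "\<dots> = ennreal (\<alpha> * pi\<^sup>2 / 4 * (T / (1 - \<alpha>)\<^sup>2))"
    using assms by (simp add: ennreal_mult'[symmetric] mult_ac)
  finally show ?thesis .
qed

lemma nn_integral_ratio_kernel_star_shaped:
  assumes "0 \<le> \<alpha>" "0 \<le> T" "0 \<le> t" "t \<le> 1"
  shows "ennreal t * (\<integral>\<^sup>+m\<in>{0<..<1}. ennreal (ratio_kernel \<alpha> T m) \<partial>lborel)
    \<le> (\<integral>\<^sup>+m\<in>{0<..<1}. ennreal (ratio_kernel \<alpha> (t * T) m) \<partial>lborel)"
proof -
  have "ennreal t * (\<integral>\<^sup>+m\<in>{0<..<1}. ennreal (ratio_kernel \<alpha> T m) \<partial>lborel)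
      = (\<integral>\<^sup>+m. ennreal t * (ennreal (ratio_kernel \<alpha> T m) * indicator {0<..<1} m) \<partial>lborel)"
    by (rule nn_integral_cmult[symmetric]) measurable
  also have "\<dots> \<le> (\<integral>\<^sup>+m\<in>{0<..<1}. ennreal (ratio_kernel \<alpha> (t * T) m) \<partial>lborel)"
    using assms
    by (intro nn_integral_mono)
      (auto simp: ennreal_mult'[symmetric] split: split_indicator
        intro!: ennreal_leI ratio_kernel_star_shaped)
  finally show ?thesis .
qed

locale iid_stable_pair = prob_space M for M :: "'a measure" +
  fixes S Z :: "'a \<Rightarrow> real" and \<alpha> :: real
  assumes indep: "indep_var borel S borel Z"
    and stable_S: "symmetric_stable \<alpha> 1 (distr M borel S)"
    and stable_Z: "symmetric_stable \<alpha> 1 (distr M borel Z)"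
    and \<alpha>_pos: "0 < \<alpha>"
begin

definition ratio_cdf :: "real \<Rightarrow> real" where
  "ratio_cdf b = \<P>(\<omega> in M. \<bar>Z \<omega>\<bar> \<le> b * \<bar>S \<omega>\<bar>)"

lemma random_variable_S[measurable]: "random_variable borel S"
  and random_variable_Z[measurable]: "random_variable borel Z"
  using indep_var_rv1[OF indep] indep_var_rv2[OF indep] by auto

lemma symmetric_stable_combination:
  "symmetric_stable \<alpha> (\<bar>p\<bar> powr \<alpha> + \<bar>q\<bar> powr \<alpha>) (distr M borel (\<lambda>\<omega>. p * Z \<omega> + q * S \<omega>))"
proof -
  have "indep_var borel (\<lambda>\<omega>. q * S \<omega>) borel (\<lambda>\<omega>. p * Z \<omega>)"
    using indep_var_compose[OF indep, of "\<lambda>x. q * x" borel "\<lambda>x. p * x" borel]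
    by (simp add: comp_def)
  moreover have "symmetric_stable \<alpha> (\<bar>q\<bar> powr \<alpha>) (distr M borel (\<lambda>\<omega>. q * S \<omega>))"
      "symmetric_stable \<alpha> (\<bar>p\<bar> powr \<alpha>) (distr M borel (\<lambda>\<omega>. p * Z \<omega>))"
    using symmetric_stable_distr_cmult[OF _ stable_S] symmetric_stable_distr_cmult[OF _ stable_Z]
    by simp_all
  ultimately have "symmetric_stable \<alpha> (\<bar>q\<bar> powr \<alpha> + \<bar>p\<bar> powr \<alpha>)
      (distr M borel (\<lambda>\<omega>. q * S \<omega> + p * Z \<omega>))"
    by (rule symmetric_stable_distr_add)
  then show ?thesis by (simp only: add.commute)
qed

lemma expectation_cos_combination:
  "expectation (\<lambda>\<omega>. cos (p * Z \<omega> + q * S \<omega>)) = exp (- (\<bar>p\<bar> powr \<alpha> + \<bar>q\<bar> powr \<alpha>))"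
proof -
  have "expectation (\<lambda>\<omega>. cos (p * Z \<omega> + q * S \<omega>)) = expectation (\<lambda>\<omega>. Re (iexp (p * Z \<omega> + q * S \<omega>)))"
    by (intro Bochner_Integration.integral_cong) (simp_all only: cis_conv_exp[symmetric] cis.simps)
  also have "\<dots> = Re (\<integral>\<omega>. iexp (p * Z \<omega> + q * S \<omega>) \<partial>M)"
    by (intro integral_Re integrable_const_bound[where B = 1]) auto
  also have "(\<integral>\<omega>. iexp (p * Z \<omega> + q * S \<omega>) \<partial>M) = char (distr M borel (\<lambda>\<omega>. p * Z \<omega> + q * S \<omega>)) 1"
    by (simp add: char_def integral_distr)
  finally show ?thesis
    using symmetric_stable_combination[of p q] by (simp add: symmetric_stable_def del: of_real_exp)
qed

lemma expectation_sin_mult_sin: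
  assumes "0 \<le> b"
  shows "expectation (\<lambda>\<omega>. sin (u * (Z \<omega> - b * S \<omega>)) * sin (v * (Z \<omega> + b * S \<omega>)))
    = sine_kernel \<alpha> (b powr \<alpha>) u v"
proof -
  have "expectation (\<lambda>\<omega>. sin (u * (Z \<omega> - b * S \<omega>)) * sin (v * (Z \<omega> + b * S \<omega>)))
    = expectation (\<lambda>\<omega>. (cos ((u - v) * Z \<omega> + (- (b * (u + v))) * S \<omega>)
        - cos ((u + v) * Z \<omega> + (b * (v - u)) * S \<omega>)) / 2)"
    by (intro Bochner_Integration.integral_cong) (auto simp: sin_times_sin algebra_simps)
  also have "\<dots> = (expectation (\<lambda>\<omega>. cos ((u - v) * Z \<omega> + (- (b * (u + v))) * S \<omega>))
        - expectation (\<lambda>\<omega>. cos ((u + v) * Z \<omega> + (b * (v - u)) * S \<omega>))) / 2"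
  proof -
    have "integrable M (\<lambda>\<omega>. cos (p * Z \<omega> + q * S \<omega>))" for p q
      by (intro integrable_const_bound[where B = 1]) auto
    then show ?thesis
      by (simp only: integral_divide_zero Bochner_Integration.integral_diff)
  qed
  finally show ?thesis
    unfolding expectation_cos_combination sine_kernel_def using assms
    by (simp add: abs_mult powr_mult abs_minus_commute)
qed

lemma AE_combination_neq_0:
  assumes "p \<noteq> 0 \<or> q \<noteq> 0"
  shows "AE \<omega> in M. p * Z \<omega> + q * S \<omega> \<noteq> 0"
proof (rule AE_neq_of_symmetric_stable[OF _ symmetric_stable_combination \<alpha>_pos])
  show "0 < \<bar>p\<bar> powr \<alpha> + \<bar>q\<bar> powr \<alpha>"
    using assms by (auto simp: add_pos_nonneg add_nonneg_pos)
qed measurable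

lemma AE_S_neq_0: "AE \<omega> in M. S \<omega> \<noteq> 0"
  using AE_combination_neq_0[of 0 1] by simp

lemma AE_abs_ratio_neq: "AE \<omega> in M. \<bar>Z \<omega>\<bar> \<noteq> b * \<bar>S \<omega>\<bar>"
proof -
  have "AE \<omega> in M. 1 * Z \<omega> + b * S \<omega> \<noteq> 0" "AE \<omega> in M. 1 * Z \<omega> + - b * S \<omega> \<noteq> 0"
    by (rule AE_combination_neq_0, simp)+
  then show ?thesis
    by eventually_elim (auto simp: abs_if split: if_splits)
qed

lemma expectation_sgn_mult_sgn_eq_ratio_cdf:
  assumes "0 \<le> b"
  shows "expectation (\<lambda>\<omega>. sgn (Z \<omega> - b * S \<omega>) * sgn (Z \<omega> + b * S \<omega>)) = 1 - 2 * ratio_cdf b"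
proof -
  let ?le = "{\<omega> \<in> space M. \<bar>Z \<omega>\<bar> \<le> b * \<bar>S \<omega>\<bar>}"
  have sgn: "sgn (z - b * s) * sgn (z + b * s) = 1 - 2 * of_bool (\<bar>z\<bar> \<le> b * \<bar>s\<bar>)"
    if "\<bar>z\<bar> \<noteq> b * \<bar>s\<bar>" for z s :: real
  proof -
    have "b * \<bar>s\<bar> = \<bar>b * s\<bar>" using assms by (simp add: abs_mult)
    then show ?thesis using that by (auto simp: sgn_real_def abs_if split: if_splits)
  qed
  have "AE \<omega> in M. sgn (Z \<omega> - b * S \<omega>) * sgn (Z \<omega> + b * S \<omega>) = 1 - 2 * indicator ?le \<omega>"
    using AE_abs_ratio_neq[of b] AE_space by eventually_elim (simp add: sgn indicator_def)
  then have "expectation (\<lambda>\<omega>. sgn (Z \<omega> - b * S \<omega>) * sgn (Z \<omega> + b * S \<omega>))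
      = expectation (\<lambda>\<omega>. 1 - 2 * indicator ?le \<omega>)"
    by (intro integral_cong_AE) auto
  also have "\<dots> = 1 - 2 * ratio_cdf b"
    by (subst Bochner_Integration.integral_diff)
      (auto simp: ratio_cdf_def prob_space Int_absorb2 sets.sets_into_space less_top[symmetric]
        intro!: integrable_real_indicator)
  finally show ?thesis .
qed

lemma nn_integral_ratio_kernel:
  assumes "0 < b" "b \<le> 1"
  shows "(\<integral>\<^sup>+m\<in>{0<..<1}. ennreal (ratio_kernel \<alpha> (b powr \<alpha>) m) \<partial>lborel)
      = ennreal (\<alpha> * pi\<^sup>2 / 4 * ratio_cdf b)"
    (is "?R = _")
proof -
  let ?L = "\<integral>\<^sup>+m\<in>{0<..<1}. ennreal (ratio_tail_kernel \<alpha> (b powr \<alpha>) m) \<partial>lborel"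
  have T: "0 < b powr \<alpha>" "b powr \<alpha> \<le> 1"
    using assms \<alpha>_pos by (auto intro!: powr_le1)
  let ?U = "\<lambda>\<omega>. Z \<omega> - b * S \<omega>" and ?V = "\<lambda>\<omega>. Z \<omega> + b * S \<omega>"
  have nonneg: "0 \<le> expectation (\<lambda>\<omega>. sin (u * ?U \<omega>) * sin (v * ?V \<omega>))" if "0 < u" "0 < v" for u v
    using that assms T \<alpha>_pos by (simp add: expectation_sin_mult_sin sine_kernel_nonneg)
  have tail_nonneg: "0 \<le> 1 - 2 * ratio_cdf b"
    using expectation_sgn_mult_sgn_nonneg[OF _ _ nonneg] assms
    by (simp add: expectation_sgn_mult_sgn_eq_ratio_cdf)
  have "ennreal (pi\<^sup>2 / 4 * (1 - 2 * ratio_cdf b)) = ennreal (2 / \<alpha>) * ?L"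
    using ennreal_expectation_sgn_mult_sgn[OF _ _ nonneg] assms T \<alpha>_pos
    by (simp add: expectation_sin_mult_sin expectation_sgn_mult_sgn_eq_ratio_cdf
      nn_integral_sine_kernel)
  then have "ennreal (\<alpha> / 2) * ennreal (pi\<^sup>2 / 4 * (1 - 2 * ratio_cdf b)) = ?L"
    using \<alpha>_pos by (simp add: mult.assoc[symmetric] ennreal_mult'[symmetric])
  then have tail: "?L = ennreal (\<alpha> / 2 * (pi\<^sup>2 / 4 * (1 - 2 * ratio_cdf b)))"
    using \<alpha>_pos by (subst ennreal_mult') auto
  have "?R = ?L + ?R - ?L"
    unfolding tail by (rule ennreal_add_diff_cancel_left[symmetric]) (rule ennreal_neq_top)
  also have "?L + ?R = ennreal (\<alpha> * (pi\<^sup>2 / 8))"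
    using \<alpha>_pos T by (intro nn_integral_ratio_kernels_add) auto
  also have "\<dots> - ?L = ennreal (\<alpha> * (pi\<^sup>2 / 8) - \<alpha> / 2 * (pi\<^sup>2 / 4 * (1 - 2 * ratio_cdf b)))"
    unfolding tail using tail_nonneg \<alpha>_pos by (intro ennreal_minus) auto
  also have "\<alpha> * (pi\<^sup>2 / 8) - \<alpha> / 2 * (pi\<^sup>2 / 4 * (1 - 2 * ratio_cdf b)) = \<alpha> * pi\<^sup>2 / 4 * ratio_cdf b"
    by (simp add: field_simps)
  finally show ?thesis .
qed

lemma ratio_cdf_nonneg: "0 \<le> ratio_cdf b"
  by (simp add: ratio_cdf_def)

lemma ratio_cdf_star_shaped:
  assumes "0 < a" "a \<le> b" "b \<le> 1"
  shows "(a / b) powr \<alpha> * ratio_cdf b \<le> ratio_cdf a"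
proof -
  define t where "t = (a / b) powr \<alpha>"
  have t: "0 \<le> t" "t \<le> 1" "a powr \<alpha> = t * b powr \<alpha>"
    using assms \<alpha>_pos by (auto simp: t_def powr_divide intro!: powr_mono2)
  have "ennreal (t * (\<alpha> * pi\<^sup>2 / 4 * ratio_cdf b))
      = ennreal t * (\<integral>\<^sup>+m\<in>{0<..<1}. ennreal (ratio_kernel \<alpha> (b powr \<alpha>) m) \<partial>lborel)"
    using assms t by (simp only: nn_integral_ratio_kernel ennreal_mult')
  also have "\<dots> \<le> (\<integral>\<^sup>+m\<in>{0<..<1}. ennreal (ratio_kernel \<alpha> (a powr \<alpha>) m) \<partial>lborel)"
    unfolding t(3) using t(1,2) \<alpha>_pos by (intro nn_integral_ratio_kernel_star_shaped) auto
  also have "\<dots> = ennreal (\<alpha> * pi\<^sup>2 / 4 * ratio_cdf a)"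
    using assms by (intro nn_integral_ratio_kernel) auto
  finally have "t * (\<alpha> * pi\<^sup>2 / 4 * ratio_cdf b) \<le> \<alpha> * pi\<^sup>2 / 4 * ratio_cdf a"
    using \<alpha>_pos ratio_cdf_nonneg by (subst (asm) ennreal_le_iff) auto
  then have "(\<alpha> * pi\<^sup>2 / 4) * (t * ratio_cdf b) \<le> (\<alpha> * pi\<^sup>2 / 4) * ratio_cdf a"
    by (simp only: mult_ac)
  then show ?thesis
    using \<alpha>_pos unfolding t_def by (subst (asm) mult_le_cancel_left_pos) auto
qed

lemma ratio_cdf_le:
  assumes "\<alpha> < 1" "0 < b" "b \<le> 1"
  shows "ratio_cdf b \<le> b powr \<alpha> / (1 - \<alpha>)\<^sup>2"
proof -
  have "ennreal (\<alpha> * pi\<^sup>2 / 4 * ratio_cdf b) \<le> ennreal (\<alpha> * pi\<^sup>2 / 4 * (b powr \<alpha> / (1 - \<alpha>)\<^sup>2))"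
    unfolding nn_integral_ratio_kernel[OF assms(2,3), symmetric]
    using assms \<alpha>_pos by (intro nn_integral_ratio_kernel_le) auto
  then have "\<alpha> * pi\<^sup>2 / 4 * ratio_cdf b \<le> \<alpha> * pi\<^sup>2 / 4 * (b powr \<alpha> / (1 - \<alpha>)\<^sup>2)"
    using assms \<alpha>_pos by (subst (asm) ennreal_le_iff) auto
  then show ?thesis
    using \<alpha>_pos by (subst (asm) mult_le_cancel_left_pos) auto
qed

lemma prob_ratio_band:
  assumes "a \<le> b"
  shows "\<P>(\<omega> in M. a * \<bar>S \<omega>\<bar> \<le> \<bar>Z \<omega>\<bar> \<and> \<bar>Z \<omega>\<bar> \<le> b * \<bar>S \<omega>\<bar>) = ratio_cdf b - ratio_cdf a"
proof -
  let ?le = "\<lambda>b. {\<omega> \<in> space M. \<bar>Z \<omega>\<bar> \<le> b * \<bar>S \<omega>\<bar>}"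
  have "\<P>(\<omega> in M. a * \<bar>S \<omega>\<bar> \<le> \<bar>Z \<omega>\<bar> \<and> \<bar>Z \<omega>\<bar> \<le> b * \<bar>S \<omega>\<bar>) = prob (?le b - ?le a)"
    using AE_abs_ratio_neq[of a] by (intro finite_measure_eq_AE) auto
  also have "\<dots> = prob (?le b) - prob (?le a)"
    using assms
    by (intro finite_measure_Diff) (auto intro: order_trans[OF _ mult_right_mono[OF assms]])
  finally show ?thesis by (simp only: ratio_cdf_def)
qed

lemma prob_uminus_S:
  assumes "Measurable.pred (borel \<Otimes>\<^sub>M borel) (\<lambda>(s, z). P s z)"
  shows "\<P>(\<omega> in M. P (- S \<omega>) (Z \<omega>)) = \<P>(\<omega> in M. P (S \<omega>) (Z \<omega>))"
proof -
  have [measurable]: "{(s, z). P s z} \<in> sets (borel \<Otimes>\<^sub>M borel)"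
    using assms by (simp add: pred_def space_pair_measure)
  have "symmetric_stable \<alpha> 1 (distr M borel (\<lambda>\<omega>. - S \<omega>))"
    using symmetric_stable_distr_cmult[OF _ stable_S, of "- 1"] by simp
  then have distr_uminus: "distr M borel (\<lambda>\<omega>. - S \<omega>) = distr M borel S"
    by (intro symmetric_stable_unique[OF _ _ _ stable_S] real_distribution_distr) auto
  have "indep_var borel (\<lambda>\<omega>. - S \<omega>) borel Z"
    using indep_var_compose[OF indep, of uminus borel "\<lambda>x. x" borel] by (simp add: comp_def)
  then have "distr M (borel \<Otimes>\<^sub>M borel) (\<lambda>\<omega>. (- S \<omega>, Z \<omega>))
      = distr M borel (\<lambda>\<omega>. - S \<omega>) \<Otimes>\<^sub>M distr M borel Z"
    by (simp add: indep_var_distribution_eq)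
  also have "\<dots> = distr M (borel \<Otimes>\<^sub>M borel) (\<lambda>\<omega>. (S \<omega>, Z \<omega>))"
    using indep by (simp add: indep_var_distribution_eq distr_uminus)
  finally have "measure (distr M (borel \<Otimes>\<^sub>M borel) (\<lambda>\<omega>. (- S \<omega>, Z \<omega>))) {(s, z). P s z}
      = measure (distr M (borel \<Otimes>\<^sub>M borel) (\<lambda>\<omega>. (S \<omega>, Z \<omega>))) {(s, z). P s z}" by simp
  then show ?thesis
    by (simp add: measure_distr vimage_def Int_def conj_commute)
qed

lemma prob_shifted_ratio:
  assumes "0 < \<epsilon>" "\<epsilon> < \<bar>x\<bar>"
  shows "\<P>(\<omega> in M. \<bar>(x * S \<omega> + Z \<omega>) / S \<omega>\<bar> \<le> \<epsilon>) = (ratio_cdf (\<bar>x\<bar> + \<epsilon>) - ratio_cdf (\<bar>x\<bar> - \<epsilon>)) / 2"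
proof -
  let ?E = "\<lambda>x. {\<omega> \<in> space M. \<bar>x * S \<omega> + Z \<omega>\<bar> \<le> \<epsilon> * \<bar>S \<omega>\<bar>}"
  have "prob (?E (- x)) = prob (?E x)"
    using prob_uminus_S[of "\<lambda>s z. \<bar>x * s + z\<bar> \<le> \<epsilon> * \<bar>s\<bar>"] by simp
  moreover have "prob (?E x \<union> ?E (- x)) = prob (?E x) + prob (?E (- x))"
  proof (rule measure_Un_AE)
    have disjoint: "s = 0" if "\<bar>x * s + z\<bar> \<le> \<epsilon> * \<bar>s\<bar>" "\<bar>- x * s + z\<bar> \<le> \<epsilon> * \<bar>s\<bar>" for s z
    proof -
      have "\<bar>x * s\<bar> \<le> \<epsilon> * \<bar>s\<bar>" using that by linarith
      then show "s = 0" using assms(2) by (simp add: abs_mult mult_le_cancel_right)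
    qed
    show "AE \<omega> in M. \<omega> \<notin> ?E x \<or> \<omega> \<notin> ?E (- x)"
      using AE_S_neq_0 by eventually_elim (use disjoint in blast)
  qed (auto simp: fmeasurable_eq_sets)
  moreover have "?E x \<union> ?E (- x)
      = {\<omega> \<in> space M. (\<bar>x\<bar> - \<epsilon>) * \<bar>S \<omega>\<bar> \<le> \<bar>Z \<omega>\<bar> \<and> \<bar>Z \<omega>\<bar> \<le> (\<bar>x\<bar> + \<epsilon>) * \<bar>S \<omega>\<bar>}"
  proof -
    have "\<bar>x * s + z\<bar> \<le> \<epsilon> * \<bar>s\<bar> \<or> \<bar>- x * s + z\<bar> \<le> \<epsilon> * \<bar>s\<bar>
        \<longleftrightarrow> (\<bar>x\<bar> - \<epsilon>) * \<bar>s\<bar> \<le> \<bar>z\<bar> \<and> \<bar>z\<bar> \<le> (\<bar>x\<bar> + \<epsilon>) * \<bar>s\<bar>" for s z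
    proof -
      have "\<bar>x\<bar> * \<bar>s\<bar> = \<bar>x * s\<bar>" by (simp add: abs_mult)
      then show ?thesis
        unfolding left_diff_distrib distrib_right by (auto simp: abs_if split: if_splits)
    qed
    then show ?thesis by blast
  qed
  ultimately have "2 * prob (?E x) = ratio_cdf (\<bar>x\<bar> + \<epsilon>) - ratio_cdf (\<bar>x\<bar> - \<epsilon>)"
    using assms(1) by (simp add: prob_ratio_band)
  moreover have "\<P>(\<omega> in M. \<bar>(x * S \<omega> + Z \<omega>) / S \<omega>\<bar> \<le> \<epsilon>) = prob (?E x)"
    using AE_S_neq_0
    by (intro finite_measure_eq_AE) (auto simp: abs_divide field_simps elim!: eventually_mono)
  ultimately show ?thesis by simp
qed

lemma prob_shifted_ratio_le:
  assumes "\<alpha> < 1" "0 < \<epsilon>" "\<epsilon> < \<bar>x\<bar>" "\<bar>x\<bar> + \<epsilon> \<le> 1"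
  shows "\<P>(\<omega> in M. \<bar>(x * S \<omega> + Z \<omega>) / S \<omega>\<bar> \<le> \<epsilon>)
    \<le> (\<bar>x\<bar> + \<epsilon>) powr \<alpha> / (2 * (1 - \<alpha>)\<^sup>2) * (1 - ((\<bar>x\<bar> - \<epsilon>) / (\<bar>x\<bar> + \<epsilon>)) powr \<alpha>)"
proof -
  define a b where "a = \<bar>x\<bar> - \<epsilon>" and "b = \<bar>x\<bar> + \<epsilon>"
  have ab: "0 < a" "a \<le> b" "0 < b" "b \<le> 1"
    using assms by (auto simp: a_def b_def)
  have "\<P>(\<omega> in M. \<bar>(x * S \<omega> + Z \<omega>) / S \<omega>\<bar> \<le> \<epsilon>) = (ratio_cdf b - ratio_cdf a) / 2"
    unfolding a_def b_def using assms by (intro prob_shifted_ratio) auto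
  also have "\<dots> \<le> ratio_cdf b / 2 * (1 - (a / b) powr \<alpha>)"
    using ratio_cdf_star_shaped[OF ab(1,2,4)] by (simp add: algebra_simps diff_divide_distrib)
  also have "\<dots> \<le> b powr \<alpha> / (1 - \<alpha>)\<^sup>2 / 2 * (1 - (a / b) powr \<alpha>)"
    using assms(1) ab \<alpha>_pos
    by (intro mult_right_mono divide_right_mono ratio_cdf_le) (auto intro!: powr_le1)
  finally show ?thesis by (simp add: a_def b_def mult.commute)
qed

end

section \<open>The minimum estimator\<close>

lemma less_one_of_powr_less_one:
  fixes r e :: real
  assumes "0 \<le> e" "r powr e < 1"
  shows "r < 1"
  using assms ge_one_powr_ge_zero[of r e] by linarith

lemma powr_mult_one_diff_powr_le:
  fixes \<alpha> r q :: real
  assumes "0 < \<alpha>" "\<alpha> \<le> 0.05" "0 < r" "r \<le> 1" "0 < q" "q \<le> 1"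
  shows "r powr \<alpha> / (2 * (1 - \<alpha>)\<^sup>2) * (1 - q powr \<alpha>)
    \<le> 3 / 4 * r powr (\<alpha> / (1 + \<alpha>)) * (1 - q powr (\<alpha> / (1 - \<alpha>)))"
proof (rule mult_mono)
  have "0.95\<^sup>2 \<le> (1 - \<alpha>)\<^sup>2"
    using assms by (intro power_mono) auto
  then have "2 / 3 \<le> (1 - \<alpha>)\<^sup>2" by (simp add: power2_eq_square)
  then have "r powr \<alpha> / (2 * (1 - \<alpha>)\<^sup>2) \<le> r powr \<alpha> / (4 / 3)"
    by (intro divide_left_mono) auto
  also have "\<dots> = 3 / 4 * r powr \<alpha>" by simp
  also have "\<dots> \<le> 3 / 4 * r powr (\<alpha> / (1 + \<alpha>))"
    using assms by (intro mult_left_mono powr_mono') (auto simp: field_simps)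
  finally show "r powr \<alpha> / (2 * (1 - \<alpha>)\<^sup>2) \<le> 3 / 4 * r powr (\<alpha> / (1 + \<alpha>))" .
  show "1 - q powr \<alpha> \<le> 1 - q powr (\<alpha> / (1 - \<alpha>))"
    using assms by (intro diff_left_mono powr_mono') (auto simp: field_simps)
  show "0 \<le> 1 - q powr \<alpha>"
    using assms by (auto intro!: powr_le1)
qed simp

lemma powr_mult_one_diff_powr_le_one:
  fixes r q :: real
  assumes "0 \<le> d" "0 \<le> r" "r \<le> 1" "0 \<le> e" "0 \<le> q" "q \<le> 1"
  shows "r powr d * (1 - q powr e) \<le> 1"
  using assms by (intro mult_le_one) (auto intro!: powr_le1)

context prob_space
begin

lemma prob_exists_le_of_indep:
  fixes Y :: "'i \<Rightarrow> 'a \<Rightarrow> 'b"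
  assumes indep: "indep_vars (\<lambda>_. N) Y J" and "finite J" "J \<noteq> {}" "B \<in> sets N"
    and bound: "\<And>j. j \<in> J \<Longrightarrow> \<P>(\<omega> in M. Y j \<omega> \<in> B) \<le> p" "p \<le> 1"
  shows "\<P>(\<omega> in M. \<exists>j\<in>J. Y j \<omega> \<in> B) \<le> 1 - (1 - p) ^ card J"
proof -
  have Y_measurable[measurable]: "Y j \<in> measurable M N" if "j \<in> J" for j
    using indep that by (auto simp: indep_vars_def)
  have hit: "{\<omega> \<in> space M. Y j \<omega> \<in> B} \<in> events" if "j \<in> J" for j
    using that \<open>B \<in> sets N\<close> by measurable
  have miss: "prob (Y j -` (space N - B) \<inter> space M) = 1 - \<P>(\<omega> in M. Y j \<omega> \<in> B)" if "j \<in> J" for j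
  proof -
    have "Y j -` (space N - B) \<inter> space M = space M - {\<omega> \<in> space M. Y j \<omega> \<in> B}"
      using measurable_space[OF Y_measurable[OF that]] by auto
    then show ?thesis using prob_compl[OF hit[OF that]] by simp
  qed
  have "(1 - p) ^ card J = (\<Prod>j\<in>J. 1 - p)" by simp
  also have "\<dots> \<le> (\<Prod>j\<in>J. prob (Y j -` (space N - B) \<inter> space M))"
    using bound by (intro prod_mono) (auto simp: miss)
  also have "\<dots> = prob (\<Inter>j\<in>J. Y j -` (space N - B) \<inter> space M)"
    using assms(2-4) by (intro indep_varsD_finite[OF indep, symmetric]) auto
  also have "(\<Inter>j\<in>J. Y j -` (space N - B) \<inter> space M) = space M - {\<omega> \<in> space M. \<exists>j\<in>J. Y j \<omega> \<in> B}"
    using \<open>J \<noteq> {}\<close> measurable_space[OF Y_measurable] by auto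
  also have "prob \<dots> = 1 - \<P>(\<omega> in M. \<exists>j\<in>J. Y j \<omega> \<in> B)"
    using \<open>finite J\<close> hit by (intro prob_compl sets.sets_Collect_finite_Ex) auto
  finally show ?thesis by simp
qed

lemma indep_vars_reindex:
  assumes "inj_on h I" and indep: "indep_vars N X (h ` I)"
  shows "indep_vars (\<lambda>k. N (h k)) (\<lambda>k. X (h k)) I"
proof -
  have "indep_vars (\<lambda>k. PiM {h k} N) (\<lambda>k \<omega>. \<lambda>p\<in>{h k}. X p \<omega>) I"
    using \<open>inj_on h I\<close>
    by (intro indep_vars_restrict[OF indep]) (auto simp: disjoint_family_on_def inj_on_eq_iff)
  then have "indep_vars (\<lambda>k. N (h k)) (\<lambda>k \<omega>. (\<lambda>p\<in>{h k}. X p \<omega>) (h k)) I"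
    by (rule indep_vars_compose2[where Y = "\<lambda>k f. f (h k)"])
      (rule measurable_component_singleton, simp)
  then show ?thesis by simp
qed

lemma indep_vars_of_columns:
  assumes indep: "indep_vars (\<lambda>_. N) (\<lambda>(k, j). X k j) (I \<times> J)"
    and g: "g \<in> measurable (PiM I (\<lambda>_. N)) L"
  shows "indep_vars (\<lambda>_. L) (\<lambda>j \<omega>. g (\<lambda>k\<in>I. X k j \<omega>)) J"
proof -
  let ?P = "\<lambda>j. PiM (I \<times> {j}) (\<lambda>_. N)"
  have "indep_vars ?P (\<lambda>j \<omega>. \<lambda>p\<in>I \<times> {j}. (case p of (k, j) \<Rightarrow> X k j) \<omega>) J"
    by (rule indep_vars_restrict[OF indep]) (auto simp: disjoint_family_on_def)
  then have "indep_vars (\<lambda>_. L)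
      (\<lambda>j \<omega>. g (\<lambda>k\<in>I. (\<lambda>p\<in>I \<times> {j}. (case p of (k, j) \<Rightarrow> X k j) \<omega>) (k, j))) J"
  proof (rule indep_vars_compose2)
    show "(\<lambda>f. g (\<lambda>k\<in>I. f (k, j))) \<in> measurable (?P j) L" for j
      by (rule measurable_compose[OF measurable_restrict g])
        (auto intro: measurable_component_singleton)
  qed
  then show ?thesis by (simp cong: restrict_cong)
qed

lemma iid_stable_pair_linear_combination:
  assumes "0 < \<alpha>" "finite K" "i \<notin> K"
    and indep: "indep_vars (\<lambda>_. borel) X (insert i K)"
    and stable: "\<And>k. k \<in> insert i K \<Longrightarrow> symmetric_stable \<alpha> 1 (distr M borel (X k))"
    and unit: "(\<Sum>k\<in>K. \<bar>w k\<bar> powr \<alpha>) = 1"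
  shows "iid_stable_pair M (X i) (\<lambda>\<omega>. \<Sum>k\<in>K. w k * X k \<omega>) \<alpha>"
proof
  have X_measurable[measurable]: "random_variable borel (X k)" if "k \<in> insert i K" for k
    using indep that by (auto simp: indep_vars_def)
  define v where "v = w(i := 1)"
  have v: "v i = 1" "\<And>k. k \<in> K \<Longrightarrow> v k = w k"
    using \<open>i \<notin> K\<close> by (auto simp: v_def)
  have indep_v: "indep_vars (\<lambda>_. borel) (\<lambda>k \<omega>. v k * X k \<omega>) (insert i K)"
    by (rule indep_vars_compose2[OF indep]) auto
  from indep_vars_sum[OF assms(2,3) this]
  show "indep_var borel (X i) borel (\<lambda>\<omega>. \<Sum>k\<in>K. w k * X k \<omega>)"
    using v by (simp cong: sum.cong)
  have "indep_vars (\<lambda>_. borel) (\<lambda>k \<omega>. v k * X k \<omega>) K"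
    by (rule indep_vars_subset[OF indep_v]) auto
  moreover have "symmetric_stable \<alpha> (\<bar>w k\<bar> powr \<alpha>) (distr M borel (\<lambda>\<omega>. v k * X k \<omega>))"
    if "k \<in> K" for k
    using symmetric_stable_distr_cmult[OF X_measurable stable, of k "w k"] that v by simp
  ultimately have "symmetric_stable \<alpha> (\<Sum>k\<in>K. \<bar>w k\<bar> powr \<alpha>) (distr M borel (\<lambda>\<omega>. \<Sum>k\<in>K. v k * X k \<omega>))"
    using \<open>finite K\<close> by (intro symmetric_stable_distr_sum)
  then show "symmetric_stable \<alpha> 1 (distr M borel (\<lambda>\<omega>. \<Sum>k\<in>K. w k * X k \<omega>))"
    using v unit by (simp cong: sum.cong)
  show "symmetric_stable \<alpha> 1 (distr M borel (X i))"
    by (rule stable) simp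
qed fact

end

locale stable_design = prob_space \<Omega> for \<Omega> :: "'a measure" +
  fixes s :: "nat \<Rightarrow> nat \<Rightarrow> 'a \<Rightarrow> real" and N M :: nat and \<alpha> :: real
  assumes indep: "indep_vars (\<lambda>_. borel) (\<lambda>(k, j). s k j) ({1..N} \<times> {1..M})"
    and stable: "\<And>k j. k \<in> {1..N} \<Longrightarrow> j \<in> {1..M} \<Longrightarrow> symmetric_stable \<alpha> 1 (distr \<Omega> borel (s k j))"
    and \<alpha>_pos: "0 < \<alpha>"
begin

definition interference_scale :: "(nat \<Rightarrow> real) \<Rightarrow> nat \<Rightarrow> real" where
  "interference_scale x i = (\<Sum>k\<in>{1..N} - {i}. \<bar>x k\<bar> powr \<alpha>) powr (1 / \<alpha>)"

lemma indep_vars_meas_ratio: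
  assumes "i \<in> {1..N}"
  shows "indep_vars (\<lambda>_. borel) (\<lambda>j \<omega>. meas x s N j \<omega> / s i j \<omega>) {1..M}"
proof -
  have "indep_vars (\<lambda>_. borel) (\<lambda>j \<omega>. (\<lambda>f. (\<Sum>k=1..N. x k * f k) / f i) (\<lambda>k\<in>{1..N}. s k j \<omega>)) {1..M}"
    using assms by (intro indep_vars_of_columns[OF indep]) measurable
  then show ?thesis
    using assms by (simp add: meas_def)
qed

lemma interference_scale_powr: "interference_scale x i powr \<alpha> = (\<Sum>k\<in>{1..N} - {i}. \<bar>x k\<bar> powr \<alpha>)"
  using \<alpha>_pos by (simp add: interference_scale_def powr_powr sum_nonneg)

lemma iid_stable_pair_interference:
  assumes "i \<in> {1..N}" "j \<in> {1..M}" "0 < interference_scale x i"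
  shows "iid_stable_pair \<Omega> (s i j) (\<lambda>\<omega>. \<Sum>k\<in>{1..N} - {i}. x k / interference_scale x i * s k j \<omega>) \<alpha>"
proof (rule iid_stable_pair_linear_combination[OF \<alpha>_pos])
  have index: "insert i ({1..N} - {i}) = {1..N}"
    using assms(1) by auto
  have "(\<lambda>k. (k, j)) ` {1..N} \<subseteq> {1..N} \<times> {1..M}"
    using assms(2) by auto
  from indep_vars_reindex[OF _ indep_vars_subset[OF indep this]]
  show "indep_vars (\<lambda>_. borel) (\<lambda>k. s k j) (insert i ({1..N} - {i}))"
    unfolding index by (simp add: inj_on_def)
  show "symmetric_stable \<alpha> 1 (distr \<Omega> borel (s k j))" if "k \<in> insert i ({1..N} - {i})" for k
    using that assms(2) unfolding index by (rule stable)
  have "(\<Sum>k\<in>{1..N} - {i}. \<bar>x k / interference_scale x i\<bar> powr \<alpha>)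
      = (\<Sum>k\<in>{1..N} - {i}. \<bar>x k\<bar> powr \<alpha>) / interference_scale x i powr \<alpha>"
    using assms(3) by (simp add: sum_divide_distrib abs_divide powr_divide)
  also have "(\<Sum>k\<in>{1..N} - {i}. \<bar>x k\<bar> powr \<alpha>) = interference_scale x i powr \<alpha>"
    by (rule interference_scale_powr[symmetric])
  finally show "(\<Sum>k\<in>{1..N} - {i}. \<bar>x k / interference_scale x i\<bar> powr \<alpha>) = 1"
    using assms(3) by simp
qed auto

lemma meas_eq_add_interference:
  assumes "i \<in> {1..N}" "0 < interference_scale x i"
  defines "\<theta> \<equiv> interference_scale x i"
  shows "meas x s N j \<omega> = \<theta> * (x i / \<theta> * s i j \<omega> + (\<Sum>k\<in>{1..N} - {i}. x k / \<theta> * s k j \<omega>))"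
  using assms sum.remove[of "{1..N}" i "\<lambda>k. x k * s k j \<omega>"]
  by (simp add: meas_def sum_distrib_left distrib_left)

lemma prob_meas_ratio_le:
  assumes "\<alpha> < 1" "i \<in> {1..N}" "j \<in> {1..M}" "0 < \<epsilon>" "\<epsilon> < \<bar>x i\<bar>"
    and scale_pos: "0 < interference_scale x i" and "\<bar>x i\<bar> + \<epsilon> \<le> interference_scale x i"
  shows "\<P>(\<omega> in \<Omega>. \<bar>meas x s N j \<omega> / s i j \<omega>\<bar> \<le> \<epsilon>)
    \<le> ((\<bar>x i\<bar> + \<epsilon>) / interference_scale x i) powr \<alpha> / (2 * (1 - \<alpha>)\<^sup>2)
      * (1 - ((\<bar>x i\<bar> - \<epsilon>) / (\<bar>x i\<bar> + \<epsilon>)) powr \<alpha>)"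
proof -
  define \<theta> where "\<theta> = interference_scale x i"
  let ?Z = "\<lambda>\<omega>. \<Sum>k\<in>{1..N} - {i}. x k / \<theta> * s k j \<omega>"
  interpret iid_stable_pair \<Omega> "s i j" ?Z \<alpha>
    unfolding \<theta>_def using assms(2,3) scale_pos by (rule iid_stable_pair_interference)
  have "0 < \<theta>" using scale_pos by (simp only: \<theta>_def)
  have "\<bar>meas x s N j \<omega> / s i j \<omega>\<bar> = \<theta> * \<bar>(x i / \<theta> * s i j \<omega> + ?Z \<omega>) / s i j \<omega>\<bar>" for \<omega>
    unfolding meas_eq_add_interference[OF assms(2) scale_pos] \<theta>_def[symmetric]
    using \<open>0 < \<theta>\<close> by (simp add: abs_mult)
  then have "\<P>(\<omega> in \<Omega>. \<bar>meas x s N j \<omega> / s i j \<omega>\<bar> \<le> \<epsilon>)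
      = \<P>(\<omega> in \<Omega>. \<bar>(x i / \<theta> * s i j \<omega> + ?Z \<omega>) / s i j \<omega>\<bar> \<le> \<epsilon> / \<theta>)"
    using \<open>0 < \<theta>\<close> by (simp only: pos_le_divide_eq mult.commute)
  also have "\<dots> \<le> (\<bar>x i / \<theta>\<bar> + \<epsilon> / \<theta>) powr \<alpha> / (2 * (1 - \<alpha>)\<^sup>2)
      * (1 - ((\<bar>x i / \<theta>\<bar> - \<epsilon> / \<theta>) / (\<bar>x i / \<theta>\<bar> + \<epsilon> / \<theta>)) powr \<alpha>)"
    using assms \<open>0 < \<theta>\<close>
    by (intro prob_shifted_ratio_le) (auto simp: \<theta>_def field_simps)
  finally show ?thesis
    using \<open>0 < \<theta>\<close> by (simp add: \<theta>_def abs_divide flip: add_divide_distrib diff_divide_distrib)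
qed

lemma prob_xhat_min_le:
  assumes "1 \<le> M" "i \<in> {1..N}" "p \<le> 1"
    and p: "\<And>j. j \<in> {1..M} \<Longrightarrow> \<P>(\<omega> in \<Omega>. \<bar>meas x s N j \<omega> / s i j \<omega>\<bar> \<le> \<epsilon>) \<le> p"
  shows "\<P>(\<omega> in \<Omega>. \<bar>xhat_min x s N M i \<omega>\<bar> \<le> \<epsilon>) \<le> 1 - (1 - p) ^ M"
proof -
  let ?Y = "\<lambda>j \<omega>. meas x s N j \<omega> / s i j \<omega>"
  note indep_Y = indep_vars_meas_ratio[OF assms(2), of x]
  have "\<P>(\<omega> in \<Omega>. \<bar>xhat_min x s N M i \<omega>\<bar> \<le> \<epsilon>) \<le> \<P>(\<omega> in \<Omega>. \<exists>j\<in>{1..M}. ?Y j \<omega> \<in> {y. \<bar>y\<bar> \<le> \<epsilon>})"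
  proof (rule finite_measure_mono)
    have "arg_min_on (\<lambda>j. \<bar>?Y j \<omega>\<bar>) {1..M} \<in> {1..M}" for \<omega>
      using assms(1) by (intro arg_min_if_finite) auto
    then show "{\<omega> \<in> space \<Omega>. \<bar>xhat_min x s N M i \<omega>\<bar> \<le> \<epsilon>}
        \<subseteq> {\<omega> \<in> space \<Omega>. \<exists>j\<in>{1..M}. ?Y j \<omega> \<in> {y. \<bar>y\<bar> \<le> \<epsilon>}}"
      unfolding xhat_min_def Let_def by blast
    have [measurable]: "?Y j \<in> borel_measurable \<Omega>" if "j \<in> {1..M}" for j
      using indep_Y that by (simp add: indep_vars_def)
    show "{\<omega> \<in> space \<Omega>. \<exists>j\<in>{1..M}. ?Y j \<omega> \<in> {y. \<bar>y\<bar> \<le> \<epsilon>}} \<in> events"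
      by (intro sets.sets_Collect_finite_Ex) measurable
  qed
  also have "\<dots> \<le> 1 - (1 - p) ^ card {1..M}"
  proof (rule prob_exists_le_of_indep[OF indep_Y])
    show "\<P>(\<omega> in \<Omega>. ?Y j \<omega> \<in> {y. \<bar>y\<bar> \<le> \<epsilon>}) \<le> p" if "j \<in> {1..M}" for j
      unfolding mem_Collect_eq by (rule p[OF that])
  qed (use assms in auto)
  finally show ?thesis by simp
qed

lemma prob_xhat_min_le_powr:
  fixes x :: "nat \<Rightarrow> real" and i :: nat and \<epsilon> :: real
  defines "r \<equiv> (\<bar>x i\<bar> + \<epsilon>) / interference_scale x i" and "q \<equiv> (\<bar>x i\<bar> - \<epsilon>) / (\<bar>x i\<bar> + \<epsilon>)"
  assumes "\<alpha> \<le> 0.05" "1 \<le> M" "i \<in> {1..N}" "0 < \<epsilon>" "\<epsilon> < \<bar>x i\<bar>" "0 < interference_scale x i" "r \<le> 1"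
  shows "\<P>(\<omega> in \<Omega>. \<bar>xhat_min x s N M i \<omega>\<bar> \<le> \<epsilon>)
    \<le> 1 - (1 - 3 / 4 * r powr (\<alpha> / (1 + \<alpha>)) * (1 - q powr (\<alpha> / (1 - \<alpha>)))) ^ M"
proof (rule prob_xhat_min_le)
  have "0 < r" and q: "0 < q" "q \<le> 1"
    using assms by (auto simp: r_def q_def)
  then show "3 / 4 * r powr (\<alpha> / (1 + \<alpha>)) * (1 - q powr (\<alpha> / (1 - \<alpha>))) \<le> 1"
    using powr_mult_one_diff_powr_le_one[of "\<alpha> / (1 + \<alpha>)" r "\<alpha> / (1 - \<alpha>)" q]
      assms(3,9) \<alpha>_pos by auto
  fix j assume "j \<in> {1..M}"
  then have "\<P>(\<omega> in \<Omega>. \<bar>meas x s N j \<omega> / s i j \<omega>\<bar> \<le> \<epsilon>) \<le> r powr \<alpha> / (2 * (1 - \<alpha>)\<^sup>2) * (1 - q powr \<alpha>)"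
    unfolding r_def q_def using assms by (intro prob_meas_ratio_le) (auto simp: r_def)
  also have "\<dots> \<le> 3 / 4 * r powr (\<alpha> / (1 + \<alpha>)) * (1 - q powr (\<alpha> / (1 - \<alpha>)))"
    using assms(3,9) \<open>0 < r\<close> q \<alpha>_pos by (intro powr_mult_one_diff_powr_le)
  finally show "\<P>(\<omega> in \<Omega>. \<bar>meas x s N j \<omega> / s i j \<omega>\<bar> \<le> \<epsilon>)
      \<le> 3 / 4 * r powr (\<alpha> / (1 + \<alpha>)) * (1 - q powr (\<alpha> / (1 - \<alpha>)))" .
qed (use assms in auto)

end

theorem theorem3:
  fixes \<Omega> :: "'a measure" and s :: "nat \<Rightarrow> nat \<Rightarrow> 'a \<Rightarrow> real"
    and x :: "nat \<Rightarrow> real" and N M i :: nat and \<alpha> \<epsilon> :: real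
  assumes "prob_space \<Omega>"
    and "0 < \<alpha>" "\<alpha> \<le> 0.05"
    and "M \<ge> 1"
    and "\<And>k j. k \<in> {1..N} \<Longrightarrow> j \<in> {1..M} \<Longrightarrow> s k j \<in> borel_measurable \<Omega>"
    and "prob_space.indep_vars \<Omega> (\<lambda>_. borel) (\<lambda>(k, j). s k j) ({1..N} \<times> {1..M})"
    and "\<And>k j t. k \<in> {1..N} \<Longrightarrow> j \<in> {1..M} \<Longrightarrow>
           char (distr \<Omega> borel (s k j)) t = complex_of_real (exp (- (\<bar>t\<bar> powr \<alpha>)))"
    and "\<epsilon> > 0"
    and "i \<in> {1..N}"
    and "\<bar>x i\<bar> > \<epsilon>"
    and "(\<Sum>t\<in>{1..N} - {i}. \<bar>x t\<bar> powr \<alpha>) powr (1 / \<alpha>) > 0"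
    and "((\<bar>x i\<bar> + \<epsilon>) / (\<Sum>t\<in>{1..N} - {i}. \<bar>x t\<bar> powr \<alpha>) powr (1 / \<alpha>))
           powr (\<alpha> / (1 - \<alpha>)) < 1 / 3"
  shows "measure \<Omega> {\<omega> \<in> space \<Omega>. \<bar>xhat_min x s N M i \<omega>\<bar> \<le> \<epsilon>}
    \<le> 1 - (1 - 3 / 4 * \<bar>(\<bar>x i\<bar> + \<epsilon>) / (\<Sum>t\<in>{1..N} - {i}. \<bar>x t\<bar> powr \<alpha>) powr (1 / \<alpha>)\<bar>
                   powr (\<alpha> / (1 + \<alpha>))
            * (1 - \<bar>(\<bar>x i\<bar> - \<epsilon>) / (\<bar>x i\<bar> + \<epsilon>)\<bar> powr (\<alpha> / (1 - \<alpha>)))) ^ M"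
proof -
  interpret stable_design \<Omega> s N M \<alpha>
    using assms(1,2,6,7)
    by (simp add: stable_design_def stable_design_axioms_def symmetric_stable_def)
  define r q where "r = (\<bar>x i\<bar> + \<epsilon>) / interference_scale x i" and "q = (\<bar>x i\<bar> - \<epsilon>) / (\<bar>x i\<bar> + \<epsilon>)"
  have scale_pos: "0 < interference_scale x i"
    using assms(11) by (simp only: interference_scale_def)
  then have "0 < r" "0 < q"
    using assms(8,10) by (auto simp: r_def q_def)
  have "r powr (\<alpha> / (1 - \<alpha>)) < 1"
    using assms(12) unfolding r_def interference_scale_def by linarith
  then have "r < 1"
    by (rule less_one_of_powr_less_one[rotated]) (use assms(2,3) in auto)
  then have "\<P>(\<omega> in \<Omega>. \<bar>xhat_min x s N M i \<omega>\<bar> \<le> \<epsilon>)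
      \<le> 1 - (1 - 3 / 4 * r powr (\<alpha> / (1 + \<alpha>)) * (1 - q powr (\<alpha> / (1 - \<alpha>)))) ^ M"
    unfolding r_def q_def using assms(3,4,8-10) scale_pos by (intro prob_xhat_min_le_powr) auto
  then show ?thesis
    unfolding interference_scale_def[symmetric] r_def[symmetric] q_def[symmetric]
      abs_of_pos[OF \<open>0 < r\<close>] abs_of_pos[OF \<open>0 < q\<close>] .
qed

end
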